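(* Let $k,m,n,A,\sigma,c$, the endpoint-anchored context algebra $\mathsf U^{\mathrm{an}}_c(A,\sigma,n)$ and its elements $L_a,R_b,S$ be as in the context. Let $C$ be a one-hole context with $q$ vertices, and let its leaves, read in planar order, be $$x_0,\ldots,x_{h-1},\star,x_{h+1},\ldots,x_{qm},\qquad h=tm+r,\quad 0\le r<m.$$ Set (with ordered products in increasing $j$) $$a_C=\Bigl(\prod_{j<h}\sigma^j(x_j)\Bigr)c^t,\qquad b_C=c^{-t}\Bigl(\prod_{j>h}\sigma^j(x_j)\Bigr)c^q.$$ Then the class $[C]$ of $C$ satisfies $$[C]=L_{a_C}R_{b_C}S^r\qquad\text{in }\mathsf U^{\mathrm{an}}_c(A,\sigma,n).$$ Moreover the right-hand side has the formal action (on the regular module $A$, where $S$ acts as $\sigma$) $$a_C\,S^r(x)\,b_C=\Bigl(\prod_{j<h}\sigma^j(x_j)\Bigr)\sigma^h(x)\Bigl(\prod_{j>h}\sigma^j(x_j)\Bigr)c^q .$$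
   Context: $k$ is a commutative unital ring, $m\ge2$, $n=m+1$, $A$ is a unital associative $k$-algebra, $c\in A^\times$, $\sigma\in\mathrm{Aut}_k(A)$ with $\sigma(c)=c$ and $\sigma^m(a)=cac^{-1}$ for all $a\in A$. The $n$-ary algebra $T(A,\sigma,c)$ is $A$ with the totally associative product $\mu_{\sigma,c}(a_0,\ldots,a_m)=a_0\sigma(a_1)\cdots\sigma^{m-1}(a_{m-1})ca_m$. A one-hole context is a finite planar rooted full $n$-ary tree (every internal vertex has exactly $n$ ordered inputs) with one distinguished leaf labelled $\star$ (the hole) and all other (ordinary) leaves labelled by elements of $A$; "vertices" means internal vertices. Take the free $k$-module on one-hole contexts modulo: multilinearity in the ordinary leaf labels; scalar contraction (a vertex all of whose inputs are ordinary leaves $a_0,\ldots,a_m$ may be replaced by one ordinary leaf labelled $\mu_{\sigma,c}(a_0,\ldots,a_m)$); and total associativity (rebracketing of two adjacent vertices). Grafting makes this an associative unital algebra: $CD$ is the context obtained by grafting $D$ into the hole of $C$, and the unit is the trivial tree $\star$. Imposing moreover (as algebra relations) the two endpoint anchors, that the one-vertex context with inputs $(\star,1,\ldots,1,c^{-1})$ and the one-vertex context with inputs $(c^{-1},1,\ldots,1,\star)$ both equal the unit, gives $\mathsf U^{\mathrm{an}}_c(A,\sigma,n)$. Input positions of a vertex are numbered $0,\ldots,m$. $L_a$ is the one-vertex context with $ac^{-1}$ in position $0$, the hole in position $m$, and $1$ elsewhere. $R_b$ is the one-vertex context with the hole in position $0$, $c^{-1}b$ in position $m$, and $1$ elsewhere.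 $S$ is the one-vertex context with the hole in position $1$, $c^{-1}$ in position $m$, and $1$ elsewhere. The regular module is $A$, with a context acting by substituting $x\in A$ into the hole and evaluating with $\mu_{\sigma,c}$. *)

theory Defs
  imports "HOL-Algebra.QuotRing" "HOL-Library.Poly_Mapping"
begin

text \<open>The sorts below are those of commutative unital and of unital associative rings; the library
  classes \<open>comm_ring_1\<close> and \<open>ring_1\<close> are avoided because they exclude the zero ring.\<close>

locale assoc_algebra =
  fixes scale :: "'k::{comm_ring,comm_monoid_mult} \<Rightarrow> 'a::{ring,monoid_mult} \<Rightarrow> 'a"
  assumes scale_add_right: "scale s (a + b) = scale s a + scale s b"
    and scale_add_left: "scale (s + s') a = scale s a + scale s' a"
    and scale_scale: "scale s (scale s' a) = scale (s * s') a"
    and scale_one: "scale 1 a = a"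
    and scale_mult_left: "scale s a * b = scale s (a * b)"
    and scale_mult_right: "a * scale s b = scale s (a * b)"

text \<open>\<open>ci\<close> is the inverse of the unit \<open>c\<close>.\<close>

locale twisted_datum = assoc_algebra scale
  for scale :: "'k::{comm_ring,comm_monoid_mult} \<Rightarrow> 'a::{ring,monoid_mult} \<Rightarrow> 'a" +
  fixes m :: nat and \<sigma> :: "'a \<Rightarrow> 'a" and c ci :: 'a
  assumes m_ge_2: "2 \<le> m"
    and c_inverse: "c * ci = 1" "ci * c = 1"
    and \<sigma>_bij: "bij \<sigma>"
    and \<sigma>_add: "\<sigma> (a + b) = \<sigma> a + \<sigma> b"
    and \<sigma>_mult: "\<sigma> (a * b) = \<sigma> a * \<sigma> b"
    and \<sigma>_one: "\<sigma> 1 = 1"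
    and \<sigma>_scale: "\<sigma> (scale s a) = scale s (\<sigma> a)"
    and \<sigma>_c: "\<sigma> c = c"
    and \<sigma>_pow_m: "(\<sigma> ^^ m) a = c * a * ci"

text \<open>The \<open>(m + 1)\<close>-ary product; it is only used on lists of length \<open>m + 1\<close>.\<close>

definition nary_prod :: "nat \<Rightarrow> ('a::monoid_mult \<Rightarrow> 'a) \<Rightarrow> 'a \<Rightarrow> 'a list \<Rightarrow> 'a" where
  "nary_prod m \<sigma> c as = prod_list (map (\<lambda>j. (\<sigma> ^^ j) (as ! j)) [0..<m]) * c * as ! m"


section \<open>One-hole contexts\<close>

datatype 'l ptree = Leaf 'l | Vertex "'l ptree list"

primrec leaves :: "'l ptree \<Rightarrow> 'l list" where
  "leaves (Leaf l) = [l]"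
| "leaves (Vertex ts) = concat (map leaves ts)"

primrec num_vertices :: "'l ptree \<Rightarrow> nat" where
  "num_vertices (Leaf l) = 0"
| "num_vertices (Vertex ts) = Suc (sum_list (map num_vertices ts))"

inductive full_tree :: "nat \<Rightarrow> 'l ptree \<Rightarrow> bool" for n where
  full_Leaf: "full_tree n (Leaf l)"
| full_Vertex: "length ts = n \<Longrightarrow> (\<And>t. t \<in> set ts \<Longrightarrow> full_tree n t) \<Longrightarrow> full_tree n (Vertex ts)"

text \<open>Leaf labels are in \<open>'a option\<close>: the label \<open>None\<close> marks the hole, \<open>Some a\<close> an ordinary leaf.\<close>

abbreviation hole :: "'a option ptree" where "hole \<equiv> Leaf None"
abbreviation lf :: "'a \<Rightarrow> 'a option ptree" where "lf a \<equiv> Leaf (Some a)"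

definition contexts :: "nat \<Rightarrow> 'a option ptree set" where
  "contexts n = {C. full_tree n C \<and> count_list (leaves C) None = 1}"

primrec graft :: "'a option ptree \<Rightarrow> 'a option ptree \<Rightarrow> 'a option ptree" where
  "graft (Leaf l) D = (case l of None \<Rightarrow> D | Some a \<Rightarrow> lf a)"
| "graft (Vertex ts) D = Vertex (map (\<lambda>t. graft t D) ts)"


section \<open>The free module on contexts, with grafting as product\<close>

text \<open>The element \<open>Poly_Mapping.single C s\<close> is the multiple of the basis element \<open>C\<close> by the scalar \<open>s\<close>.
  The product is the bilinear extension of grafting.\<close>

definition graft_mult :: "('a option ptree \<Rightarrow>\<^sub>0 'k::{comm_ring,comm_monoid_mult})
    \<Rightarrow> ('a option ptree \<Rightarrow>\<^sub>0 'k) \<Rightarrow> ('a option ptree \<Rightarrow>\<^sub>0 'k)" where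
  "graft_mult f g = (\<Sum>C\<in>Poly_Mapping.keys f. \<Sum>D\<in>Poly_Mapping.keys g.
     Poly_Mapping.single (graft C D) (Poly_Mapping.lookup f C * Poly_Mapping.lookup g D))"

definition free_context_ring ::
    "nat \<Rightarrow> ('a option ptree \<Rightarrow>\<^sub>0 'k::{comm_ring,comm_monoid_mult}) ring" where
  "free_context_ring n =
     \<lparr>carrier = {f. Poly_Mapping.keys f \<subseteq> contexts n}, mult = graft_mult,
      one = Poly_Mapping.single hole 1, zero = 0, add = (+)\<rparr>"

text \<open>The library ideal generated by a set is defined as an intersection of ideals and is only
  meaningful over a ring, hence the following.\<close>

lemma graft_mult_superset:
  assumes "finite A" "finite B" "Poly_Mapping.keys f \<subseteq> A" "Poly_Mapping.keys g \<subseteq> B"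
  shows "graft_mult f g = (\<Sum>C\<in>A. \<Sum>D\<in>B.
     Poly_Mapping.single (graft C D) (Poly_Mapping.lookup f C * Poly_Mapping.lookup g D))"
proof -
  have "graft_mult f g = (\<Sum>C\<in>Poly_Mapping.keys f. \<Sum>D\<in>B.
     Poly_Mapping.single (graft C D) (Poly_Mapping.lookup f C * Poly_Mapping.lookup g D))"
    unfolding graft_mult_def
    by (intro sum.cong refl sum.mono_neutral_left) (use assms in \<open>auto simp: in_keys_iff\<close>)
  also have "\<dots> = (\<Sum>C\<in>A. \<Sum>D\<in>B.
     Poly_Mapping.single (graft C D) (Poly_Mapping.lookup f C * Poly_Mapping.lookup g D))"
    by (intro sum.mono_neutral_left) (use assms in \<open>auto simp: in_keys_iff\<close>)
  finally show ?thesis .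
qed

lemma graft_mult_add_left: "graft_mult (f + g) h = graft_mult f h + graft_mult g h"
proof -
  let ?A = "Poly_Mapping.keys f \<union> Poly_Mapping.keys g"
  have "graft_mult p h = (\<Sum>C\<in>?A. \<Sum>D\<in>Poly_Mapping.keys h. Poly_Mapping.single (graft C D)
      (Poly_Mapping.lookup p C * Poly_Mapping.lookup h D))" if "Poly_Mapping.keys p \<subseteq> ?A" for p
    by (rule graft_mult_superset) (use that in auto)
  then show ?thesis
    using Poly_Mapping.keys_add[of f g]
    by (simp add: lookup_add single_add distrib_right sum.distrib)
qed

lemma graft_mult_add_right: "graft_mult h (f + g) = graft_mult h f + graft_mult h g"
proof -
  let ?A = "Poly_Mapping.keys f \<union> Poly_Mapping.keys g"
  have "graft_mult h p = (\<Sum>C\<in>Poly_Mapping.keys h. \<Sum>D\<in>?A. Poly_Mapping.single (graft C D)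
      (Poly_Mapping.lookup h C * Poly_Mapping.lookup p D))" if "Poly_Mapping.keys p \<subseteq> ?A" for p
    by (rule graft_mult_superset) (use that in auto)
  then show ?thesis
    using Poly_Mapping.keys_add[of f g]
    by (simp add: lookup_add single_add distrib_left sum.distrib)
qed

lemma graft_mult_zero [simp]: "graft_mult 0 f = 0" "graft_mult f 0 = 0"
  by (simp_all add: graft_mult_def)

lemma graft_mult_sum_left: "graft_mult (sum F A) h = (\<Sum>i\<in>A. graft_mult (F i) h)"
  by (induction A rule: infinite_finite_induct) (simp_all add: graft_mult_add_left)

lemma graft_mult_sum_right: "graft_mult h (sum F A) = (\<Sum>i\<in>A. graft_mult h (F i))"
  by (induction A rule: infinite_finite_induct) (simp_all add: graft_mult_add_right)

lemma graft_mult_single: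
  "graft_mult (Poly_Mapping.single C s) (Poly_Mapping.single D s') =
     Poly_Mapping.single (graft C D) (s * s')"
  by (subst graft_mult_superset[of "{C}" "{D}"]) auto

lemma graft_assoc: "graft (graft C D) E = graft C (graft D E)"
  by (induction C) (auto split: option.splits)

lemma graft_hole_left [simp]: "graft hole D = D"
  by simp

lemma graft_hole_right [simp]: "graft C hole = C"
  by (induction C) (auto split: option.splits intro: map_idI)

lemma sum_singles: "f = (\<Sum>C\<in>Poly_Mapping.keys f. Poly_Mapping.single C (Poly_Mapping.lookup f C))"
  by (rule poly_mapping_eqI) (simp add: lookup_sum lookup_single when_def in_keys_iff)

lemma graft_mult_assoc: "graft_mult (graft_mult f g) h = graft_mult f (graft_mult g h)"
proof -
  have "graft_mult (graft_mult (sum F A) (sum G B)) (sum H D) =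
      graft_mult (sum F A) (graft_mult (sum G B) (sum H D))"
    if "\<And>i j l. graft_mult (graft_mult (F i) (G j)) (H l) = graft_mult (F i) (graft_mult (G j) (H l))"
    for F G H :: "'a option ptree \<Rightarrow> ('a option ptree \<Rightarrow>\<^sub>0 'b)" and A B D
    unfolding graft_mult_sum_left graft_mult_sum_right that ..
  then show ?thesis
    by (subst (1 2) sum_singles[of f], subst (1 2) sum_singles[of g], subst (1 2) sum_singles[of h])
      (simp add: graft_mult_single graft_assoc mult.assoc)
qed

lemma hole_in_contexts: "hole \<in> contexts n"
  by (simp add: contexts_def full_Leaf)

lemma full_tree_graft: "full_tree n C \<Longrightarrow> full_tree n D \<Longrightarrow> full_tree n (graft C D)"
proof (induction C rule: full_tree.induct)
  case (full_Vertex ts)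
  then show ?case
    unfolding graft.simps by (intro full_tree.full_Vertex) auto
qed (auto intro: full_tree.intros split: option.splits)

lemma count_list_concat: "count_list (concat xss) x = sum_list (map (\<lambda>xs. count_list xs x) xss)"
  by (induction xss) simp_all

lemma count_hole_graft:
  "count_list (leaves (graft C D)) None = count_list (leaves C) None * count_list (leaves D) None"
proof (induction C)
  case (Vertex ts)
  have "map (\<lambda>t. count_list (leaves (graft t D)) None) ts =
      map (\<lambda>t. count_list (leaves t) None * count_list (leaves D) None) ts"
    using Vertex by simp
  then have "sum_list (map (\<lambda>t. count_list (leaves (graft t D)) None) ts) =
      sum_list (map (\<lambda>t. count_list (leaves t) None * count_list (leaves D) None) ts)"
    by presburger
  then show ?case
    by (simp add: count_list_concat comp_def sum_list_mult_const)
qed (auto split: option.splits)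

lemma graft_in_contexts: "C \<in> contexts n \<Longrightarrow> D \<in> contexts n \<Longrightarrow> graft C D \<in> contexts n"
  by (auto simp: contexts_def full_tree_graft count_hole_graft)

lemma keys_graft_mult:
  assumes "Poly_Mapping.keys f \<subseteq> contexts n" "Poly_Mapping.keys g \<subseteq> contexts n"
  shows "Poly_Mapping.keys (graft_mult f g) \<subseteq> contexts n"
proof -
  have sub: "Poly_Mapping.keys (sum F A) \<subseteq> contexts n"
    if "\<And>i. i \<in> A \<Longrightarrow> Poly_Mapping.keys (F i) \<subseteq> contexts n"
    for F :: "'a option ptree \<Rightarrow> ('a option ptree \<Rightarrow>\<^sub>0 'b)" and A
    using that
  proof (induction A rule: infinite_finite_induct)
    case (insert i A)
    then show ?case using Poly_Mapping.keys_add[of "F i" "sum F A"] by auto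
  qed auto
  show ?thesis
    unfolding graft_mult_def
    by (intro sub) (use assms in \<open>auto split: if_splits intro: graft_in_contexts\<close>)
qed

lemma free_context_ring_is_ring: "ring (free_context_ring n)"
proof (rule ringI)
  show "abelian_group (free_context_ring n :: ('a option ptree \<Rightarrow>\<^sub>0 'b::{comm_ring,comm_monoid_mult}) ring)"
  proof (rule abelian_groupI)
    fix f :: "'a option ptree \<Rightarrow>\<^sub>0 'b" assume "f \<in> carrier (free_context_ring n)"
    then show "\<exists>g\<in>carrier (free_context_ring n). g \<oplus>\<^bsub>free_context_ring n\<^esub> f = \<zero>\<^bsub>free_context_ring n\<^esub>"
      by (intro bexI[of _ "- f"]) (auto simp: free_context_ring_def in_keys_iff)
  next
    fix f g :: "'a option ptree \<Rightarrow>\<^sub>0 'b"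
    assume "f \<in> carrier (free_context_ring n)" "g \<in> carrier (free_context_ring n)"
    then show "f \<oplus>\<^bsub>free_context_ring n\<^esub> g \<in> carrier (free_context_ring n)"
      using Poly_Mapping.keys_add[of f g] by (auto simp: free_context_ring_def)
  qed (simp_all add: free_context_ring_def ac_simps)
  show "monoid (free_context_ring n :: ('a option ptree \<Rightarrow>\<^sub>0 'b::{comm_ring,comm_monoid_mult}) ring)"
  proof (rule monoidI)
    fix f :: "'a option ptree \<Rightarrow>\<^sub>0 'b"
    have "graft_mult (Poly_Mapping.single hole 1) f = f"
      by (subst (1 2) sum_singles[of f]) (simp add: graft_mult_sum_right graft_mult_single)
    then show "\<one>\<^bsub>free_context_ring n\<^esub> \<otimes>\<^bsub>free_context_ring n\<^esub> f = f"
      by (simp add: free_context_ring_def)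
    have "graft_mult f (Poly_Mapping.single hole 1) = f"
      by (subst (1 2) sum_singles[of f]) (simp add: graft_mult_sum_left graft_mult_single)
    then show "f \<otimes>\<^bsub>free_context_ring n\<^esub> \<one>\<^bsub>free_context_ring n\<^esub> = f"
      by (simp add: free_context_ring_def)
  qed (auto simp: free_context_ring_def graft_mult_assoc hole_in_contexts keys_graft_mult[THEN subsetD])
qed (simp_all add: free_context_ring_def graft_mult_add_left graft_mult_add_right)


section \<open>The endpoint-anchored context algebra\<close>

text \<open>Each of the following relations is generated by a move on a subtree, closed under placing that
  subtree at some input of a vertex.\<close>

inductive leaf_add :: "'a::plus option ptree \<Rightarrow> 'a option ptree \<Rightarrow> 'a option ptree \<Rightarrow> bool" where
  "leaf_add (lf (a + b)) (lf a) (lf b)"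
| "leaf_add t t1 t2 \<Longrightarrow>
     leaf_add (Vertex (us @ [t] @ vs)) (Vertex (us @ [t1] @ vs)) (Vertex (us @ [t2] @ vs))"

inductive leaf_scale ::
    "('k \<Rightarrow> 'a \<Rightarrow> 'a) \<Rightarrow> 'k \<Rightarrow> 'a option ptree \<Rightarrow> 'a option ptree \<Rightarrow> bool" for scale s where
  "leaf_scale scale s (lf (scale s a)) (lf a)"
| "leaf_scale scale s t t1 \<Longrightarrow>
     leaf_scale scale s (Vertex (us @ [t] @ vs)) (Vertex (us @ [t1] @ vs))"

inductive contraction :: "nat \<Rightarrow> ('a::monoid_mult \<Rightarrow> 'a) \<Rightarrow> 'a
    \<Rightarrow> 'a option ptree \<Rightarrow> 'a option ptree \<Rightarrow> bool" for m \<sigma> c where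
  "length as = m + 1 \<Longrightarrow> contraction m \<sigma> c (Vertex (map lf as)) (lf (nary_prod m \<sigma> c as))"
| "contraction m \<sigma> c t t1 \<Longrightarrow>
     contraction m \<sigma> c (Vertex (us @ [t] @ vs)) (Vertex (us @ [t1] @ vs))"

text \<open>Two adjacent vertices have \<open>2 m + 1\<close> inputs in total; the lower vertex may take over any
  \<open>m + 1\<close> consecutive ones of them. The inputs are arbitrary trees and may contain the hole.\<close>

inductive rebracketing :: "nat \<Rightarrow> 'a option ptree \<Rightarrow> 'a option ptree \<Rightarrow> bool" for m where
  "us @ ws @ vs = us' @ ws' @ vs' \<Longrightarrow> length ws = m + 1 \<Longrightarrow> length ws' = m + 1 \<Longrightarrow>
     length us + length vs = m \<Longrightarrow> length us' + length vs' = m \<Longrightarrow>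
     rebracketing m (Vertex (us @ [Vertex ws] @ vs)) (Vertex (us' @ [Vertex ws'] @ vs'))"
| "rebracketing m t t1 \<Longrightarrow>
     rebracketing m (Vertex (us @ [t] @ vs)) (Vertex (us @ [t1] @ vs))"

abbreviation basis :: "'a option ptree \<Rightarrow> ('a option ptree \<Rightarrow>\<^sub>0 'k::{comm_ring,comm_monoid_mult})" where
  "basis C \<equiv> Poly_Mapping.single C 1"

definition context_relators :: "nat \<Rightarrow> ('k::{comm_ring,comm_monoid_mult} \<Rightarrow> 'a::{ring,monoid_mult} \<Rightarrow> 'a)
    \<Rightarrow> ('a \<Rightarrow> 'a) \<Rightarrow> 'a \<Rightarrow> ('a option ptree \<Rightarrow>\<^sub>0 'k) set" where
  "context_relators m scale \<sigma> c =
     {basis C - basis C1 - basis C2 | C C1 C2.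
        leaf_add C C1 C2 \<and> {C, C1, C2} \<subseteq> contexts (m + 1)} \<union>
     {basis C - Poly_Mapping.single C1 s | s C C1.
        leaf_scale scale s C C1 \<and> {C, C1} \<subseteq> contexts (m + 1)} \<union>
     {basis C - basis C1 | C C1. contraction m \<sigma> c C C1 \<and> {C, C1} \<subseteq> contexts (m + 1)} \<union>
     {basis C - basis C1 | C C1. rebracketing m C C1 \<and> {C, C1} \<subseteq> contexts (m + 1)}"

definition anchor_relators ::
    "nat \<Rightarrow> 'a::monoid_mult \<Rightarrow> ('a option ptree \<Rightarrow>\<^sub>0 'k::{comm_ring,comm_monoid_mult}) set" where
  "anchor_relators m ci =
     {basis (Vertex ([hole] @ replicate (m - 1) (lf 1) @ [lf ci])) - basis hole,
      basis (Vertex ([lf ci] @ replicate (m - 1) (lf 1) @ [hole])) - basis hole}"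

text \<open>The \<open>context_relators\<close> are closed under grafting on either side, so that the submodule they span
  is already an ideal of the free module; imposing the anchors on the quotient algebra amounts to
  dividing by the two-sided ideal generated by both sets. A two-sided ideal is automatically a
  submodule, since the scalars embed as multiples of the unit.\<close>

definition anchored_ideal where
  "anchored_ideal m scale \<sigma> c ci =
     Idl\<^bsub>free_context_ring (m + 1)\<^esub> (context_relators m scale \<sigma> c \<union> anchor_relators m ci)"

definition anchored_algebra :: "nat \<Rightarrow> ('k::{comm_ring,comm_monoid_mult} \<Rightarrow> 'a::{ring,monoid_mult} \<Rightarrow> 'a)
    \<Rightarrow> ('a \<Rightarrow> 'a) \<Rightarrow> 'a \<Rightarrow> 'a \<Rightarrow> ('a option ptree \<Rightarrow>\<^sub>0 'k) set ring" where
  "anchored_algebra m scale \<sigma> c ci =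
     free_context_ring (m + 1) Quot anchored_ideal m scale \<sigma> c ci"

definition context_class :: "nat \<Rightarrow> ('k::{comm_ring,comm_monoid_mult} \<Rightarrow> 'a::{ring,monoid_mult} \<Rightarrow> 'a)
    \<Rightarrow> ('a \<Rightarrow> 'a) \<Rightarrow> 'a \<Rightarrow> 'a \<Rightarrow> 'a option ptree \<Rightarrow> ('a option ptree \<Rightarrow>\<^sub>0 'k) set" where
  "context_class m scale \<sigma> c ci C =
     anchored_ideal m scale \<sigma> c ci +>\<^bsub>free_context_ring (m + 1)\<^esub> basis C"

definition L_context :: "nat \<Rightarrow> 'a::monoid_mult \<Rightarrow> 'a \<Rightarrow> 'a option ptree" where
  "L_context m ci a = Vertex ([lf (a * ci)] @ replicate (m - 1) (lf 1) @ [hole])"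

definition R_context :: "nat \<Rightarrow> 'a::monoid_mult \<Rightarrow> 'a \<Rightarrow> 'a option ptree" where
  "R_context m ci b = Vertex ([hole] @ replicate (m - 1) (lf 1) @ [lf (ci * b)])"

definition S_context :: "nat \<Rightarrow> 'a::monoid_mult \<Rightarrow> 'a option ptree" where
  "S_context m ci = Vertex ([lf 1, hole] @ replicate (m - 2) (lf 1) @ [lf ci])"


section \<open>The regular module\<close>

primrec eval_tree :: "nat \<Rightarrow> ('a::monoid_mult \<Rightarrow> 'a) \<Rightarrow> 'a \<Rightarrow> 'a ptree \<Rightarrow> 'a" where
  "eval_tree m \<sigma> c (Leaf a) = a"
| "eval_tree m \<sigma> c (Vertex ts) = nary_prod m \<sigma> c (map (eval_tree m \<sigma> c) ts)"

definition context_act :: "nat \<Rightarrow> ('a::monoid_mult \<Rightarrow> 'a) \<Rightarrow> 'a \<Rightarrow> 'a option ptree \<Rightarrow> 'a \<Rightarrow> 'a" where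
  "context_act m \<sigma> c C x = eval_tree m \<sigma> c (map_ptree (case_option x id) C)"

definition free_act :: "nat \<Rightarrow> ('k::{comm_ring,comm_monoid_mult} \<Rightarrow> 'a::{ring,monoid_mult} \<Rightarrow> 'a)
    \<Rightarrow> ('a \<Rightarrow> 'a) \<Rightarrow> 'a \<Rightarrow> ('a option ptree \<Rightarrow>\<^sub>0 'k) \<Rightarrow> 'a \<Rightarrow> 'a" where
  "free_act m scale \<sigma> c f x =
     (\<Sum>C\<in>Poly_Mapping.keys f. scale (Poly_Mapping.lookup f C) (context_act m \<sigma> c C x))"

text \<open>The action of an element \<open>X\<close> of the quotient: the common value of all its representatives.\<close>

definition regular_act :: "nat \<Rightarrow> ('k::{comm_ring,comm_monoid_mult} \<Rightarrow> 'a::{ring,monoid_mult} \<Rightarrow> 'a)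
    \<Rightarrow> ('a \<Rightarrow> 'a) \<Rightarrow> 'a \<Rightarrow> ('a option ptree \<Rightarrow>\<^sub>0 'k) set \<Rightarrow> 'a \<Rightarrow> 'a" where
  "regular_act m scale \<sigma> c X x = the_elem ((\<lambda>f. free_act m scale \<sigma> c f x) ` X)"

end

theory Submission
  imports Defs
begin

text \<open>The idea is that a context is determined in the anchored algebra by two coefficients, the twisted products
  \<open>x\<^sub>0 * \<sigma> x\<^sub>1 * \<sigma>\<^sup>2 x\<^sub>2 * \<dots>\<close> of the leaves on either side of the hole, together with the position of the hole and the
  number of vertices.

  For a corolla, that is, a context with a single vertex, this is a consequence of the anchors. Multiplying a
  corolla by the unit, written as a corolla whose inputs are mostly ones, makes room for a new window of
  \<open>m + 1\<close> consecutive inputs that contains all of the inputs on one side of the hole. Rebracketing onto this window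
  and contracting it leaves a context that depends on those inputs only through their twisted product
  (\<open>corolla_left_twisted_prod\<close> and \<open>corolla_right_twisted_prod\<close>). The inputs may hence be concentrated in
  one extreme letter, which is split off as a factor \<open>L\<close> or \<open>R\<close>. What is left over is a corolla whose ordinary
  inputs are ones and a final inverse of \<open>c\<close>, and this is a power of \<open>S\<close> (\<open>S_pow_eq\<close>). Altogether a corolla
  with the hole in position \<open>p\<close> is a product \<open>L a R b S\<^sup>p\<close> (\<open>corolla_eq_L_R_S\<close>).

  Further single rebracketings show that \<open>L\<close> is multiplicative, \<open>R\<close> is antimultiplicative, the two commute, and \<open>S\<close>
  passes both of them at the cost of applying \<open>\<sigma>\<close>; moreover \<open>S\<^sup>m = L c R d\<close> for the inverse \<open>d\<close> of \<open>c\<close>, which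
  reflects that \<open>\<sigma>\<^sup>m\<close> is conjugation by \<open>c\<close>. So products of the form \<open>L a R b S\<^sup>h\<close> are closed under
  multiplication. An arbitrary context is a product of corollas, one for each vertex between the root and
  the hole, once the subtrees beside this path have been contracted to leaves. Induction along the path gives the
  normal form with the unreduced exponent \<open>h\<close> (\<open>context_normal_form\<close>), and \<open>S\<^sup>m = L c R d\<close>
  then reduces \<open>h = t m + r\<close> to \<open>r\<close>.

  For the action, the evaluation of a tree is the twisted product of its leaves times a power of \<open>c\<close>
  (\<open>eval_tree_eq_and_length\<close>). From this closed form it follows that all relators act as zero, so
  that the action descends to the quotient (\<open>regular_act_cls\<close>), and it also yields the formula for the
  action of the class of a context.\<close>


section \<open>Twisted products of words\<close>

text \<open>This is the coefficient product \<open>x\<^sub>0 * \<sigma> x\<^sub>1 * \<sigma>\<^sup>2 x\<^sub>2 * \<dots>\<close> in Horner form, which makes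
  concatenation of words a one-line induction. It is the coefficient of \<open>s\<close> to the power of the
  length in the product \<open>x\<^sub>0 s x\<^sub>1 s \<dots>\<close> of the skew polynomial ring with \<open>s a = \<sigma> a s\<close>.\<close>

primrec twisted_prod :: "('a::monoid_mult \<Rightarrow> 'a) \<Rightarrow> 'a list \<Rightarrow> 'a" where
  "twisted_prod \<sigma> [] = 1"
| "twisted_prod \<sigma> (x # xs) = x * \<sigma> (twisted_prod \<sigma> xs)"

context twisted_datum
begin

abbreviation tw :: "'a list \<Rightarrow> 'a" where "tw \<equiv> twisted_prod \<sigma>"

lemma \<sigma>_ci: "\<sigma> ci = ci"
proof -
  have "\<sigma> ci = (ci * c) * \<sigma> ci" by (simp add: c_inverse)
  also have "\<dots> = ci * \<sigma> (c * ci)" by (simp add: \<sigma>_mult \<sigma>_c mult.assoc)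
  finally show ?thesis by (simp add: c_inverse \<sigma>_one)
qed

lemma c_cancel: "c * (ci * a) = a" "ci * (c * a) = a"
  by (simp_all add: c_inverse mult.assoc[symmetric])

lemma power_cancel: "c ^ j * ci ^ j = 1" "ci ^ j * c ^ j = 1"
proof (induction j)
  case (Suc j)
  { case 1
    have "c ^ Suc j * ci ^ Suc j = c * (c ^ j * ci ^ j) * ci"
      by (simp add: power_commutes mult.assoc)
    then show ?case using Suc by (simp add: c_inverse) }
  { case 2
    have "ci ^ Suc j * c ^ Suc j = ci * (ci ^ j * c ^ j) * c"
      by (simp add: power_commutes mult.assoc)
    then show ?case using Suc by (simp add: c_inverse) }
qed simp_all

lemma power_cancel_left: "c ^ j * (ci ^ j * a) = a" "ci ^ j * (c ^ j * a) = a"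
  by (simp_all add: power_cancel mult.assoc[symmetric])

lemma \<sigma>_power: "\<sigma> (a ^ j) = \<sigma> a ^ j"
  by (induction j) (simp_all add: \<sigma>_one \<sigma>_mult)

lemma funpow_\<sigma>:
  "(\<sigma> ^^ j) 1 = 1" "(\<sigma> ^^ j) c = c" "(\<sigma> ^^ j) ci = ci"
  "(\<sigma> ^^ j) (a * b) = (\<sigma> ^^ j) a * (\<sigma> ^^ j) b"
  "(\<sigma> ^^ j) (c ^ i) = c ^ i" "(\<sigma> ^^ j) (ci ^ i) = ci ^ i"
  "(\<sigma> ^^ j) (a + b) = (\<sigma> ^^ j) a + (\<sigma> ^^ j) b"
  "(\<sigma> ^^ j) (scale s a) = scale s ((\<sigma> ^^ j) a)"
  by (induction j)
    (simp_all add: \<sigma>_one \<sigma>_c \<sigma>_ci \<sigma>_mult \<sigma>_power \<sigma>_add \<sigma>_scale)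

lemma funpow_\<sigma>_m: "(\<sigma> ^^ (j * m)) a = c ^ j * a * ci ^ j"
proof (induction j)
  case (Suc j)
  have "(\<sigma> ^^ (Suc j * m)) a = (\<sigma> ^^ m) ((\<sigma> ^^ (j * m)) a)"
    by (simp add: funpow_add)
  also have "\<dots> = c * (c ^ j * a * ci ^ j) * ci"
    unfolding Suc by (rule \<sigma>_pow_m)
  finally show ?case by (simp add: mult.assoc power_commutes)
qed simp

lemma twisted_prod_append: "tw (xs @ ys) = tw xs * (\<sigma> ^^ length xs) (tw ys)"
  by (induction xs) (simp_all add: \<sigma>_mult mult.assoc)

lemma twisted_prod_ones: "tw (replicate j 1) = 1"
  by (induction j) (simp_all add: \<sigma>_one)

lemma prod_list_eq_twisted_prod:
  "prod_list (map (\<lambda>j. (\<sigma> ^^ j) (y j)) [i..<k]) = (\<sigma> ^^ i) (tw (map y [i..<k]))"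
proof (induction "k - i" arbitrary: i)
  case 0
  then show ?case by (simp add: funpow_\<sigma>)
next
  case (Suc d)
  then have eq: "[i..<k] = i # [Suc i..<k]" by (simp add: upt_rec)
  have "prod_list (map (\<lambda>j. (\<sigma> ^^ j) (y j)) [Suc i..<k]) = (\<sigma> ^^ Suc i) (tw (map y [Suc i..<k]))"
    using Suc by simp
  then show ?case
    unfolding eq by (simp add: funpow_\<sigma> funpow_swap1)
qed

lemma nary_prod_eq:
  assumes "length as = m + 1"
  shows "nary_prod m \<sigma> c as = tw as * c"
proof -
  have "as = take m as @ [as ! m]"
    using assms by (metis add.right_neutral add_Suc_right One_nat_def lessI take_Suc_conv_app_nth
        take_all_iff order_refl)
  then have "tw as = tw (take m as) * (\<sigma> ^^ m) (as ! m)"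
    using assms twisted_prod_append[of "take m as" "[as ! m]"] by (simp add: \<sigma>_one)
  moreover have "take m as = map ((!) as) [0..<m]"
    using assms by (intro nth_equalityI) auto
  ultimately show ?thesis
    using prod_list_eq_twisted_prod[of "(!) as" 0 m]
    by (simp add: nary_prod_def \<sigma>_pow_m mult.assoc c_inverse)
qed


section \<open>Evaluation of trees\<close>

text \<open>A tree with \<open>v\<close> vertices has \<open>v m + 1\<close> leaves, so a factor to its right is shifted by
  \<open>\<sigma>\<close> to the power \<open>v m + 1\<close>. As \<open>\<sigma> ^^ m\<close> is conjugation by \<open>c\<close>, that shift is a single \<open>\<sigma>\<close>
  up to moving \<open>c ^ v\<close> across; all powers of \<open>c\<close> therefore collect at the right end.\<close>

lemma eval_forest_eq:
  assumes "\<And>t. t \<in> set ts \<Longrightarrow> eval_tree m \<sigma> c t = tw (leaves t) * c ^ num_vertices t \<and>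
      length (leaves t) = num_vertices t * m + 1"
  shows "tw (map (eval_tree m \<sigma> c) ts) =
      tw (concat (map leaves ts)) * c ^ sum_list (map num_vertices ts) \<and>
    length (concat (map leaves ts)) = sum_list (map num_vertices ts) * m + length ts"
  using assms
proof (induction ts)
  case (Cons t ts)
  let ?v = "num_vertices t" and ?w = "sum_list (map num_vertices ts)"
  let ?X = "tw (concat (map leaves ts))"
  have shift: "(\<sigma> ^^ (?v * m + 1)) ?X * c ^ ?v = c ^ ?v * \<sigma> ?X"
    using funpow_\<sigma>_m[of ?v "\<sigma> ?X"]
    by (simp add: funpow_swap1 mult.assoc power_cancel)
  have "tw (concat (map leaves (t # ts))) * c ^ (?v + ?w)
      = tw (leaves t) * ((\<sigma> ^^ (?v * m + 1)) ?X * c ^ ?v) * c ^ ?w"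
    using Cons.prems[of t] by (simp add: twisted_prod_append power_add mult.assoc)
  also have "\<dots> = tw (leaves t) * c ^ ?v * \<sigma> (?X * c ^ ?w)"
    by (simp only: shift) (simp add: mult.assoc \<sigma>_mult \<sigma>_power \<sigma>_c)
  also have "\<dots> = eval_tree m \<sigma> c t * \<sigma> (tw (map (eval_tree m \<sigma> c) ts))"
    using Cons by simp
  finally show ?case
    using Cons by (simp add: algebra_simps)
qed simp

text \<open>The value of a tree depends only on the word of its leaves: this is total associativity of the
  \<open>n\<close>-ary product in closed form. It makes the invariance of evaluation under rebracketing immediate.\<close>

lemma eval_tree_eq_and_length:
  assumes "full_tree (m + 1) t"
  shows "eval_tree m \<sigma> c t = tw (leaves t) * c ^ num_vertices t \<and>
    length (leaves t) = num_vertices t * m + 1"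
  using assms
proof (induction rule: full_tree.induct)
  case (full_Leaf l)
  show ?case by (simp add: \<sigma>_one)
next
  case (full_Vertex ts)
  show ?case
    using eval_forest_eq[of ts] full_Vertex
    by (simp add: nary_prod_eq mult.assoc power_commutes)
qed

end

lemma leaves_map_ptree: "leaves (map_ptree f t) = map f (leaves t)"
  by (induction t) (simp_all add: map_concat comp_def cong: map_cong)

lemma num_vertices_map_ptree [simp]: "num_vertices (map_ptree f t) = num_vertices t"
proof (induction t)
  case (Vertex ts)
  then show ?case by (simp add: comp_def cong: map_cong)
qed simp

lemma full_tree_Vertex_iff:
  "full_tree n (Vertex ts) \<longleftrightarrow> length ts = n \<and> (\<forall>t\<in>set ts. full_tree n t)"
  by (auto elim: full_tree.cases intro: full_tree.intros)

lemma full_tree_Leaf [simp]: "full_tree n (Leaf l)"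
  by (rule full_Leaf)

lemma full_tree_map_ptree [simp]: "full_tree n (map_ptree f t) = full_tree n t"
  by (induction t) (simp_all add: full_tree_Vertex_iff)

lemma map_ptree_cong_leaves:
  "(\<And>l. l \<in> set (leaves t) \<Longrightarrow> f l = g l) \<Longrightarrow> map_ptree f t = map_ptree g t"
  by (induction t) auto

lemma ordinary_tree:
  assumes "None \<notin> set (leaves t)"
  obtains t' where "t = map_ptree Some t'"
proof
  have "map_ptree (Some \<circ> the) t = map_ptree id t"
    using assms by (intro map_ptree_cong_leaves) (auto, metis option.collapse)
  then show "t = map_ptree Some (map_ptree the t)"
    by (simp add: ptree.map_comp ptree.map_id)
qed

lemma ordinary_forest:
  assumes "\<And>t. t \<in> set ts \<Longrightarrow> None \<notin> set (leaves t)"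
  obtains ts' where "ts = map (map_ptree Some) ts'"
proof -
  have "\<forall>t\<in>set ts. \<exists>t'. t = map_ptree Some t'"
    using assms ordinary_tree by metis
  then have "ts \<in> lists (range (map_ptree Some))" by auto
  then show ?thesis
    using that by (metis lists_image lists_UNIV rangeE)
qed

lemma around_hole_unique:
  "map Some us @ None # map Some vs = map Some us' @ None # map Some vs' \<Longrightarrow> us = us' \<and> vs = vs'"
proof (induction us arbitrary: us')
  case Nil
  then show ?case by (cases us') (auto simp: inj_map_eq_map)
next
  case (Cons u us)
  then show ?case by (cases us') auto
qed

lemma context_leaves:
  assumes "count_list xs None = 1"
  obtains us vs where "xs = map Some us @ None # map Some vs"
proof -
  have ordinary: "\<exists>ws. ys = map Some ws" if "None \<notin> set ys" for ys :: "'b option list"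
    using that by (intro exI[of _ "map the ys"]) (auto simp: comp_def intro!: map_idI[symmetric], metis option.collapse)
  have "None \<in> set xs"
    using assms by (metis count_notin zero_neq_one)
  then obtain ys zs where split: "xs = ys @ None # zs" "None \<notin> set ys"
    by (metis split_list_first)
  then have "None \<notin> set zs"
    using assms by (simp add: count_list_0_iff)
  then show ?thesis using that split ordinary by blast
qed

context twisted_datum
begin

lemma context_act_twisted_prod:
  assumes "full_tree (m + 1) C"
  shows "context_act m \<sigma> c C y = tw (map (case_option y id) (leaves C)) * c ^ num_vertices C"
  using eval_tree_eq_and_length[of "map_ptree (case_option y id) C"] assms
  by (simp add: context_act_def leaves_map_ptree)

lemma context_act_closed_form:
  assumes "full_tree (m + 1) C" "leaves C = map Some us @ None # map Some vs"
  shows "context_act m \<sigma> c C y = tw us * (\<sigma> ^^ length us) y *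
    (\<sigma> ^^ Suc (length us)) (tw vs) * c ^ num_vertices C"
  using context_act_twisted_prod[OF assms(1)] assms(2)
  by (simp add: comp_def twisted_prod_append funpow_\<sigma> mult.assoc funpow_swap1)

text \<open>Linearity in the hole is read off the closed form, in which the hole occurs exactly once
  and only under the linear map \<open>\<sigma> ^^ h\<close>.\<close>

lemma context_act_linear:
  assumes "C \<in> contexts (m + 1)"
  shows "context_act m \<sigma> c C (y + z) = context_act m \<sigma> c C y + context_act m \<sigma> c C z"
    and "context_act m \<sigma> c C (scale s y) = scale s (context_act m \<sigma> c C y)"
proof -
  have full: "full_tree (m + 1) C" and "count_list (leaves C) None = 1"
    using assms by (simp_all add: contexts_def)
  then obtain us vs where "leaves C = map Some us @ None # map Some vs"
    using context_leaves by blast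
  note form = context_act_closed_form[OF full this]
  show "context_act m \<sigma> c C (y + z) = context_act m \<sigma> c C y + context_act m \<sigma> c C z"
    "context_act m \<sigma> c C (scale s y) = scale s (context_act m \<sigma> c C y)"
    by (simp_all add: form funpow_\<sigma> distrib_left distrib_right scale_mult_left scale_mult_right mult.assoc)
qed

lemma context_act_graft:
  "context_act m \<sigma> c (graft C D) y = context_act m \<sigma> c C (context_act m \<sigma> c D y)"
  unfolding context_act_def
proof (induction C)
  case (Vertex ts)
  then show ?case by (simp add: comp_def cong: map_cong)
qed (simp split: option.splits)

end


section \<open>The moves defining the relations\<close>

text \<open>The action of a context depends only on its leaves and its number of vertices, so for
  additivity, scalars and rebracketing these two data are all that has to be tracked along a move when
  the relators are shown to act as zero.\<close>

lemma leaf_add_leaves: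
  assumes "leaf_add C C1 C2"
  shows "\<exists>us a b vs. leaves C = us @ Some (a + b) # vs \<and> leaves C1 = us @ Some a # vs \<and>
    leaves C2 = us @ Some b # vs \<and> num_vertices C1 = num_vertices C \<and> num_vertices C2 = num_vertices C"
  using assms
proof induction
  case (1 a b)
  show ?case by (intro exI[of _ "[]"]) auto
next
  case (2 t t1 t2 us vs)
  then obtain us' a b vs' where "leaves t = us' @ Some (a + b) # vs'" "leaves t1 = us' @ Some a # vs'"
    "leaves t2 = us' @ Some b # vs'" "num_vertices t1 = num_vertices t" "num_vertices t2 = num_vertices t"
    by blast
  then show ?case
    by (intro exI[of _ "concat (map leaves us) @ us'"] exI[of _ a] exI[of _ b]
        exI[of _ "vs' @ concat (map leaves vs)"]) simp
qed

lemma leaf_scale_leaves: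
  assumes "leaf_scale scale s C C1"
  shows "\<exists>us a vs. leaves C = us @ Some (scale s a) # vs \<and> leaves C1 = us @ Some a # vs \<and>
    num_vertices C1 = num_vertices C"
  using assms
proof induction
  case (1 a)
  show ?case by (intro exI[of _ "[]"]) auto
next
  case (2 t t1 us vs)
  then obtain us' a vs' where "leaves t = us' @ Some (scale s a) # vs'" "leaves t1 = us' @ Some a # vs'"
    "num_vertices t1 = num_vertices t"
    by blast
  then show ?case
    by (intro exI[of _ "concat (map leaves us) @ us'"] exI[of _ a]
        exI[of _ "vs' @ concat (map leaves vs)"]) simp
qed

lemma rebracketing_leaves:
  "rebracketing m C C1 \<Longrightarrow> leaves C1 = leaves C \<and> num_vertices C1 = num_vertices C"
proof (induction rule: rebracketing.induct)
  case (1 us ws vs us' ws' vs')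
  have "concat (map leaves (us @ ws @ vs)) = concat (map leaves (us' @ ws' @ vs'))"
    "sum_list (map num_vertices (us @ ws @ vs)) = sum_list (map num_vertices (us' @ ws' @ vs'))"
    using 1 by simp_all
  then show ?case by simp
qed simp

lemma contraction_eval:
  "contraction m \<sigma> c C C1 \<Longrightarrow> context_act m \<sigma> c C y = context_act m \<sigma> c C1 y"
  by (induction rule: contraction.induct) (simp_all add: context_act_def comp_def)

lemma contraction_full_count:
  "contraction m \<sigma> c C C1 \<Longrightarrow> (full_tree (m + 1) C \<longrightarrow> full_tree (m + 1) C1) \<and>
    count_list (leaves C1) None = count_list (leaves C) None"
proof (induction rule: contraction.induct)
  case (1 as)
  then show ?case by (simp add: count_list_concat comp_def)
qed (simp_all add: full_tree_Vertex_iff count_list_append)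

lemma contraction_in_contexts:
  "contraction m \<sigma> c C C1 \<Longrightarrow> C \<in> contexts (m + 1) \<Longrightarrow> C1 \<in> contexts (m + 1)"
  using contraction_full_count by (fastforce simp: contexts_def)

lemma contractions_in_vertex:
  "(contraction m \<sigma> c)\<^sup>*\<^sup>* t t1 \<Longrightarrow>
    (contraction m \<sigma> c)\<^sup>*\<^sup>* (Vertex (us @ [t] @ vs)) (Vertex (us @ [t1] @ vs))"
proof (induction rule: rtranclp_induct)
  case (step y z)
  from contraction.intros(2)[OF step.hyps(2)] show ?case
    by (rule rtranclp.rtrancl_into_rtrancl[OF step.IH])
qed simp

lemma contractions_in_forest:
  assumes "\<And>t. t \<in> set ts \<Longrightarrow> (contraction m \<sigma> c)\<^sup>*\<^sup>* (f t) (g t)"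
  shows "(contraction m \<sigma> c)\<^sup>*\<^sup>* (Vertex (us @ map f ts @ vs)) (Vertex (us @ map g ts @ vs))"
  using assms
proof (induction ts arbitrary: us)
  case (Cons t ts)
  have "(contraction m \<sigma> c)\<^sup>*\<^sup>* (Vertex (us @ [f t] @ map f ts @ vs)) (Vertex (us @ [g t] @ map f ts @ vs))"
    using Cons.prems by (intro contractions_in_vertex) simp
  moreover have "(contraction m \<sigma> c)\<^sup>*\<^sup>* (Vertex ((us @ [g t]) @ map f ts @ vs)) (Vertex ((us @ [g t]) @ map g ts @ vs))"
    using Cons.prems by (intro Cons.IH) simp
  ultimately show ?case by simp
qed simp

text \<open>Scalar contraction from the top of the tree down to a single leaf; this is how the subtrees next to the
  path from the root to the hole are removed in the normal form.\<close>

lemma contract_ordinary_tree: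
  "full_tree (m + 1) t \<Longrightarrow> (contraction m \<sigma> c)\<^sup>*\<^sup>* (map_ptree Some t) (lf (eval_tree m \<sigma> c t))"
proof (induction rule: full_tree.induct)
  case (full_Vertex ts)
  have "(contraction m \<sigma> c)\<^sup>*\<^sup>* (Vertex (map (map_ptree Some) ts))
      (Vertex (map lf (map (eval_tree m \<sigma> c) ts)))"
    using contractions_in_forest[of ts m \<sigma> c "map_ptree Some" "\<lambda>t. lf (eval_tree m \<sigma> c t)" "[]" "[]"]
      full_Vertex.IH by (simp add: comp_def)
  also have "contraction m \<sigma> c (Vertex (map lf (map (eval_tree m \<sigma> c) ts)))
      (lf (nary_prod m \<sigma> c (map (eval_tree m \<sigma> c) ts)))"
    using full_Vertex by (intro contraction.intros) simp
  finally show ?case by simp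
qed simp


section \<open>The anchored algebra as a quotient ring\<close>

lemma free_context_ring_simps:
  "carrier (free_context_ring n) = {f. Poly_Mapping.keys f \<subseteq> contexts n}"
  "mult (free_context_ring n) = graft_mult"
  "one (free_context_ring n) = basis hole"
  "zero (free_context_ring n) = 0"
  "add (free_context_ring n) = (+)"
  by (simp_all add: free_context_ring_def)

lemma basis_in_carrier: "C \<in> contexts n \<Longrightarrow> Poly_Mapping.single C s \<in> carrier (free_context_ring n)"
  by (simp add: free_context_ring_simps)

lemma diff_in_carrier:
  "f \<in> carrier (free_context_ring n) \<Longrightarrow> g \<in> carrier (free_context_ring n) \<Longrightarrow>
    f - g \<in> carrier (free_context_ring n)"
  by (auto simp: free_context_ring_simps in_keys_iff lookup_minus) (metis diff_zero subsetD in_keys_iff)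

lemma a_minus_free_context_ring:
  assumes "f \<in> carrier (free_context_ring n)" "g \<in> carrier (free_context_ring n)"
  shows "f \<ominus>\<^bsub>free_context_ring n\<^esub> g = f - g"
proof -
  interpret ring "free_context_ring n" by (rule free_context_ring_is_ring)
  have "- g \<in> carrier (free_context_ring n)"
    using assms diff_in_carrier[of 0 n g] by (simp add: free_context_ring_simps)
  then have "\<ominus>\<^bsub>free_context_ring n\<^esub> g = - g"
    using assms by (intro minus_equality) (simp_all add: free_context_ring_simps)
  then show ?thesis
    by (simp add: a_minus_def free_context_ring_simps)
qed

lemma one_vertex_in_contexts:
  "Vertex (map lf us @ [hole] @ map lf vs) \<in> contexts n \<longleftrightarrow> length us + length vs + 1 = n"
proof -
  have "count_list (concat (map (leaves \<circ> lf) us)) None = 0" for us :: "'a list"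
    by (simp add: count_list_0_iff)
  then show ?thesis
    by (auto simp: contexts_def full_tree_Vertex_iff)
qed

context twisted_datum
begin

abbreviation F :: "('a option ptree \<Rightarrow>\<^sub>0 'k) ring" where
  "F \<equiv> free_context_ring (m + 1)"
abbreviation I :: "('a option ptree \<Rightarrow>\<^sub>0 'k) set" where
  "I \<equiv> anchored_ideal m scale \<sigma> c ci"
abbreviation U :: "('a option ptree \<Rightarrow>\<^sub>0 'k) set ring" where
  "U \<equiv> anchored_algebra m scale \<sigma> c ci"
abbreviation cls :: "'a option ptree \<Rightarrow> ('a option ptree \<Rightarrow>\<^sub>0 'k) set" where
  "cls \<equiv> context_class m scale \<sigma> c ci"

lemma anchor_contexts:
  "Vertex ([hole] @ replicate (m - 1) (lf 1) @ [lf ci]) \<in> contexts (m + 1)"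
  "Vertex ([lf ci] @ replicate (m - 1) (lf 1) @ [hole]) \<in> contexts (m + 1)"
  using m_ge_2 one_vertex_in_contexts[of "[]" "replicate (m - 1) 1 @ [ci]" "m + 1"]
    one_vertex_in_contexts[of "[ci] @ replicate (m - 1) 1" "[]" "m + 1"]
  by (simp_all add: map_replicate_const)

lemma relators_in_carrier: "context_relators m scale \<sigma> c \<union> anchor_relators m ci \<subseteq> carrier F"
  using anchor_contexts hole_in_contexts[of "m + 1"]
  unfolding context_relators_def anchor_relators_def
  by (auto intro!: diff_in_carrier basis_in_carrier)

lemma ideal_I: "ideal I F"
  unfolding anchored_ideal_def
  by (rule ring.genideal_ideal[OF free_context_ring_is_ring relators_in_carrier])

lemma relators_in_I: "context_relators m scale \<sigma> c \<union> anchor_relators m ci \<subseteq> I"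
  unfolding anchored_ideal_def
  by (rule ring.genideal_self[OF free_context_ring_is_ring relators_in_carrier])

lemma ring_U: "ring U"
  unfolding anchored_algebra_def by (rule ideal.quotient_is_ring[OF ideal_I])

lemma cls_hom: "(\<lambda>f. I +>\<^bsub>F\<^esub> f) \<in> ring_hom F U"
  unfolding anchored_algebra_def by (rule ideal.rcos_ring_hom[OF ideal_I])

lemma cls_eqI:
  assumes "C \<in> contexts (m + 1)" "D \<in> contexts (m + 1)" "basis C - basis D \<in> I"
  shows "cls C = cls D"
  unfolding context_class_def
proof (rule iffD1[OF ring.quotient_eq_iff_same_a_r_cos[OF free_context_ring_is_ring ideal_I]])
  show basis: "basis C \<in> carrier F" "basis D \<in> carrier F"
    by (rule basis_in_carrier, fact)+
  show "basis C \<ominus>\<^bsub>F\<^esub> basis D \<in> I"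
    using assms(3) unfolding a_minus_free_context_ring[OF basis] .
qed

lemma cls_carrier: "C \<in> contexts (m + 1) \<Longrightarrow> cls C \<in> carrier U"
  unfolding context_class_def by (rule ring_hom_closed[OF cls_hom]) (rule basis_in_carrier)

lemma cls_graft:
  assumes "C \<in> contexts (m + 1)" "D \<in> contexts (m + 1)"
  shows "cls (graft C D) = cls C \<otimes>\<^bsub>U\<^esub> cls D"
  using ring_hom_mult[OF cls_hom basis_in_carrier[OF assms(1)] basis_in_carrier[OF assms(2)], of 1 1]
  by (simp add: context_class_def free_context_ring_simps graft_mult_single)

lemma cls_hole: "cls hole = \<one>\<^bsub>U\<^esub>"
  using ring_hom_one[OF cls_hom] by (simp add: context_class_def free_context_ring_simps)

text \<open>Relators only relate two contexts, hence the induction carries along that contraction does not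
  leave the set of contexts.\<close>

lemma cls_contraction:
  assumes "(contraction m \<sigma> c)\<^sup>*\<^sup>* C D" "C \<in> contexts (m + 1)"
  shows "cls C = cls D"
proof -
  have "D \<in> contexts (m + 1) \<and> cls C = cls D"
    using assms
  proof (induction rule: rtranclp_induct)
    case (step D E)
    have "E \<in> contexts (m + 1)" using step contraction_in_contexts by blast
    moreover from this have "basis D - basis E \<in> I"
      using step relators_in_I unfolding context_relators_def by blast
    ultimately show ?case using step cls_eqI by metis
  qed simp
  then show ?thesis by simp
qed

lemma cls_rebracketing:
  assumes "rebracketing m C D" "C \<in> contexts (m + 1)" "D \<in> contexts (m + 1)"
  shows "cls C = cls D"
  using assms relators_in_I unfolding context_relators_def by (intro cls_eqI) blast+


section \<open>The action on the regular module is well defined\<close>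

lemma scale_zero: "scale 0 a = 0" "scale s 0 = 0"
  using scale_add_left[of 0 0 a] scale_add_right[of s 0 0] by simp_all

abbreviation linear_act :: "('a option ptree \<Rightarrow>\<^sub>0 'k) \<Rightarrow> 'a \<Rightarrow> 'a" where
  "linear_act \<equiv> free_act m scale \<sigma> c"

lemma free_act_superset:
  assumes "finite X" "Poly_Mapping.keys f \<subseteq> X"
  shows "linear_act f y = (\<Sum>C\<in>X. scale (Poly_Mapping.lookup f C) (context_act m \<sigma> c C y))"
  unfolding free_act_def
  by (intro sum.mono_neutral_left) (use assms in \<open>auto simp: in_keys_iff scale_zero\<close>)

lemma free_act_single: "linear_act (Poly_Mapping.single C s) y = scale s (context_act m \<sigma> c C y)"
  by (subst free_act_superset[of "{C}"]) auto

lemma free_act_add: "linear_act (f + g) y = linear_act f y + linear_act g y"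
proof -
  let ?X = "Poly_Mapping.keys f \<union> Poly_Mapping.keys g"
  have "linear_act p y = (\<Sum>C\<in>?X. scale (Poly_Mapping.lookup p C) (context_act m \<sigma> c C y))"
    if "Poly_Mapping.keys p \<subseteq> ?X" for p
    by (rule free_act_superset) (use that in auto)
  then show ?thesis
    using Poly_Mapping.keys_add[of f g] by (simp add: lookup_add scale_add_left sum.distrib)
qed

lemma free_act_zero: "linear_act 0 y = 0"
  by (simp add: free_act_def)

lemma free_act_diff: "linear_act (f - g) y = linear_act f y - linear_act g y"
  using free_act_add[of "f - g" g y] by simp

lemma free_act_sum: "linear_act (sum f X) y = (\<Sum>i\<in>X. linear_act (f i) y)"
  by (induction X rule: infinite_finite_induct) (simp_all add: free_act_zero free_act_add)

lemma scale_sum: "scale s (sum f X) = (\<Sum>i\<in>X. scale s (f i))"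
  by (induction X rule: infinite_finite_induct) (simp_all add: scale_zero scale_add_right)

lemma context_act_zero:
  "C \<in> contexts (m + 1) \<Longrightarrow> context_act m \<sigma> c C 0 = 0"
  using context_act_linear(1)[of C 0 0] by simp

lemma context_act_sum:
  "C \<in> contexts (m + 1) \<Longrightarrow> context_act m \<sigma> c C (sum f X) = (\<Sum>i\<in>X. context_act m \<sigma> c C (f i))"
  by (induction X rule: infinite_finite_induct) (simp_all add: context_act_zero context_act_linear)

lemma free_act_mult:
  assumes "f \<in> carrier F"
  shows "linear_act (graft_mult f g) y = linear_act f (linear_act g y)"
proof -
  have "linear_act (graft_mult f g) y = (\<Sum>C\<in>Poly_Mapping.keys f. \<Sum>D\<in>Poly_Mapping.keys g.
      scale (Poly_Mapping.lookup f C * Poly_Mapping.lookup g D)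
        (context_act m \<sigma> c C (context_act m \<sigma> c D y)))"
    by (simp add: graft_mult_def free_act_sum free_act_single context_act_graft)
  also have "\<dots> = linear_act f (linear_act g y)"
    unfolding free_act_def[of m scale \<sigma> c f] free_act_def[of m scale \<sigma> c g]
  proof (intro sum.cong refl)
    fix C assume "C \<in> Poly_Mapping.keys f"
    then have C: "C \<in> contexts (m + 1)"
      using assms by (auto simp: free_context_ring_simps)
    show "(\<Sum>D\<in>Poly_Mapping.keys g. scale (Poly_Mapping.lookup f C * Poly_Mapping.lookup g D)
        (context_act m \<sigma> c C (context_act m \<sigma> c D y))) =
      scale (Poly_Mapping.lookup f C) (context_act m \<sigma> c C
        (\<Sum>D\<in>Poly_Mapping.keys g. scale (Poly_Mapping.lookup g D) (context_act m \<sigma> c D y)))"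
      by (simp add: context_act_sum[OF C] context_act_linear[OF C] scale_sum scale_scale)
  qed
  finally show ?thesis .
qed

lemma context_act_one_vertex:
  assumes "length us + length vs = m"
  shows "context_act m \<sigma> c (Vertex (map lf us @ [hole] @ map lf vs)) y = tw (us @ y # vs) * c"
  using nary_prod_eq[of "us @ y # vs"] assms by (simp add: context_act_def comp_def)

lemma relators_act_zero:
  assumes "f \<in> context_relators m scale \<sigma> c \<union> anchor_relators m ci"
  shows "linear_act f y = 0"
  using assms unfolding context_relators_def Un_iff
proof (elim disjE)
  assume "f \<in> {basis C - basis C1 - basis C2 | C C1 C2.
        leaf_add C C1 C2 \<and> {C, C1, C2} \<subseteq> contexts (m + 1)}"
  then obtain C C1 C2 where f: "f = basis C - basis C1 - basis C2" and move: "leaf_add C C1 C2"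
    and "C \<in> contexts (m + 1)" "C1 \<in> contexts (m + 1)" "C2 \<in> contexts (m + 1)" by auto
  then have full: "full_tree (m + 1) C" "full_tree (m + 1) C1" "full_tree (m + 1) C2"
    by (simp_all add: contexts_def)
  from leaf_add_leaves[OF move] show "linear_act f y = 0"
    by (auto simp: f free_act_diff free_act_single scale_one full[THEN context_act_twisted_prod]
        twisted_prod_append funpow_\<sigma> distrib_left distrib_right)
next
  assume "f \<in> {basis C - Poly_Mapping.single C1 s | s C C1.
        leaf_scale scale s C C1 \<and> {C, C1} \<subseteq> contexts (m + 1)}"
  then obtain C C1 s where f: "f = basis C - Poly_Mapping.single C1 s" and move: "leaf_scale scale s C C1"
    and "C \<in> contexts (m + 1)" "C1 \<in> contexts (m + 1)" by auto
  then have full: "full_tree (m + 1) C" "full_tree (m + 1) C1"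
    by (simp_all add: contexts_def)
  from leaf_scale_leaves[OF move] show "linear_act f y = 0"
    by (auto simp: f free_act_diff free_act_single scale_one full[THEN context_act_twisted_prod]
        twisted_prod_append funpow_\<sigma> scale_mult_left scale_mult_right)
next
  assume "f \<in> {basis C - basis C1 | C C1. contraction m \<sigma> c C C1 \<and> {C, C1} \<subseteq> contexts (m + 1)}"
  then show "linear_act f y = 0"
    by (auto simp: free_act_diff free_act_single scale_one contraction_eval)
next
  assume "f \<in> {basis C - basis C1 | C C1. rebracketing m C C1 \<and> {C, C1} \<subseteq> contexts (m + 1)}"
  then show "linear_act f y = 0"
    by (auto simp: free_act_diff free_act_single scale_one context_act_twisted_prod contexts_def
        dest!: rebracketing_leaves)
next
  assume f: "f \<in> anchor_relators m ci"
  have "context_act m \<sigma> c hole y = y" by (simp add: context_act_def)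
  moreover have "context_act m \<sigma> c (Vertex ([hole] @ replicate (m - 1) (lf 1) @ [lf ci])) y = y"
    using context_act_one_vertex[of "[]" "replicate (m - 1) 1 @ [ci]"] m_ge_2
    by (simp add: map_replicate_const twisted_prod_append twisted_prod_ones funpow_\<sigma> \<sigma>_one \<sigma>_ci
        c_inverse mult.assoc)
  moreover have "context_act m \<sigma> c (Vertex ([lf ci] @ replicate (m - 1) (lf 1) @ [hole])) y = y"
    using context_act_one_vertex[of "ci # replicate (m - 1) 1" "[]" y] m_ge_2
      \<sigma>_pow_m[of y] funpow.simps(2)[of "m - 1" \<sigma>]
    by (simp add: map_replicate_const twisted_prod_append twisted_prod_ones \<sigma>_one
        c_inverse c_cancel mult.assoc)
  ultimately show "linear_act f y = 0"
    using f by (auto simp: anchor_relators_def free_act_diff free_act_single scale_one)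
qed

text \<open>The ideal divided out is the smallest one containing the relators. That all elements of a coset act
  in the same way therefore follows once the elements acting as zero are known to form a two-sided ideal;
  stability under multiplication from the left uses that contexts act linearly.\<close>

lemma annihilator_ideal: "ideal {f \<in> carrier F. \<forall>y. linear_act f y = 0} F"
proof (rule idealI[OF free_context_ring_is_ring])
  interpret ring F by (rule free_context_ring_is_ring)
  have minus: "\<ominus>\<^bsub>F\<^esub> f = 0 - f" if "f \<in> carrier F" for f
    using that a_minus_free_context_ring[of 0 "m + 1" f] zero_closed l_zero[of "\<ominus>\<^bsub>F\<^esub> f"]
    by (simp add: a_minus_def free_context_ring_simps)
  show "subgroup {f \<in> carrier F. \<forall>y. linear_act f y = 0} (add_monoid F)"
  proof (rule add.subgroupI)
    fix f assume "f \<in> {f \<in> carrier F. \<forall>y. linear_act f y = 0}"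
    then have "f \<in> carrier F" "\<forall>y. linear_act (\<ominus>\<^bsub>F\<^esub> f) y = 0"
      using minus by (simp_all add: free_act_diff free_act_zero del: diff_0)
    then show "\<ominus>\<^bsub>F\<^esub> f \<in> {f \<in> carrier F. \<forall>y. linear_act f y = 0}"
      using a_inv_closed by blast
  next
    fix f g assume "f \<in> {f \<in> carrier F. \<forall>y. linear_act f y = 0}" "g \<in> {f \<in> carrier F. \<forall>y. linear_act f y = 0}"
    then show "f \<oplus>\<^bsub>F\<^esub> g \<in> {f \<in> carrier F. \<forall>y. linear_act f y = 0}"
      using add.m_closed[of f g] by (auto simp: free_context_ring_simps(5) free_act_add)
  next
    show "{f \<in> carrier F. \<forall>y. linear_act f y = 0} \<noteq> {}"
      using zero_closed free_act_zero unfolding free_context_ring_simps(4) by blast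
  qed auto
next
  interpret ring F by (rule free_context_ring_is_ring)
  fix f g assume fg: "f \<in> {f \<in> carrier F. \<forall>y. linear_act f y = 0}" "g \<in> carrier F"
  have "linear_act g 0 = 0"
    using fg(2) by (auto simp: free_act_def context_act_zero free_context_ring_simps subset_iff scale_zero
        intro!: sum.neutral)
  then show "g \<otimes>\<^bsub>F\<^esub> f \<in> {f \<in> carrier F. \<forall>y. linear_act f y = 0}"
    using fg m_closed[of g f] by (auto simp: free_context_ring_simps(2) free_act_mult)
  show "f \<otimes>\<^bsub>F\<^esub> g \<in> {f \<in> carrier F. \<forall>y. linear_act f y = 0}"
    using fg m_closed[of f g] by (auto simp: free_context_ring_simps(2) free_act_mult)
qed

lemma regular_act_cls: "regular_act m scale \<sigma> c (cls C) y = context_act m \<sigma> c C y"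
proof -
  have "I \<subseteq> {f \<in> carrier F. \<forall>y. linear_act f y = 0}"
    unfolding anchored_ideal_def
    using relators_in_carrier relators_act_zero
    by (intro ring.genideal_minimal[OF free_context_ring_is_ring annihilator_ideal]) blast
  then have "linear_act f y = context_act m \<sigma> c C y" if "f \<in> cls C" for f
    using that by (auto simp: context_class_def a_r_coset_def' free_context_ring_simps(5)
        free_act_add free_act_single scale_one)
  moreover have "cls C \<noteq> {}"
    using additive_subgroup.zero_closed[OF ideal.axioms(1)[OF ideal_I]]
    by (auto simp: context_class_def a_r_coset_def')
  ultimately have "(\<lambda>f. linear_act f y) ` cls C = {context_act m \<sigma> c C y}" by auto
  then show ?thesis by (simp add: regular_act_def)
qed


section \<open>Products of corollas\<close>

sublocale U: ring U
  by (rule ring_U)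

text \<open>Kept opaque, since all computations with one-vertex contexts happen on the two words around the hole.\<close>

definition corolla :: "'a list \<Rightarrow> 'a list \<Rightarrow> ('a option ptree \<Rightarrow>\<^sub>0 'k) set" where
  "corolla us vs = cls (Vertex (map lf us @ [hole] @ map lf vs))"

lemma corolla_carrier: "length us + length vs = m \<Longrightarrow> corolla us vs \<in> carrier U"
  unfolding corolla_def by (rule cls_carrier) (simp only: one_vertex_in_contexts)

lemma corolla_mult:
  assumes "length us + length vs = m" "length us' + length vs' = m"
  shows "corolla us vs \<otimes>\<^bsub>U\<^esub> corolla us' vs' =
    cls (Vertex (map lf us @ [Vertex (map lf us' @ [hole] @ map lf vs')] @ map lf vs))"
    (is "?l = cls ?C")
    and "Vertex (map lf us @ [Vertex (map lf us' @ [hole] @ map lf vs')] @ map lf vs) \<in> contexts (m + 1)"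
proof -
  let ?C = "Vertex (map lf us @ [Vertex (map lf us' @ [hole] @ map lf vs')] @ map lf vs)"
  have ctx: "Vertex (map lf us @ [hole] @ map lf vs) \<in> contexts (m + 1)"
    "Vertex (map lf us' @ [hole] @ map lf vs') \<in> contexts (m + 1)"
    unfolding one_vertex_in_contexts using assms by simp_all
  have graft: "graft (Vertex (map lf us @ [hole] @ map lf vs)) (Vertex (map lf us' @ [hole] @ map lf vs')) = ?C"
    by simp
  show "?l = cls ?C"
    using cls_graft[OF ctx] unfolding graft corolla_def by simp
  show "?C \<in> contexts (m + 1)"
    using graft_in_contexts[OF ctx] unfolding graft .
qed

text \<open>Rebracketing with the hole in the lower vertex both before and after the move: a product of two
  corollas depends only on the two words around the hole, however the letters are distributed.\<close>

lemma corolla_mult_regraft: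
  assumes "length us + length vs = m" "length us' + length vs' = m"
    and "length xs + length ys = m" "length xs' + length ys' = m"
    and "us @ us' = xs @ xs'" "vs' @ vs = ys' @ ys"
  shows "corolla us vs \<otimes>\<^bsub>U\<^esub> corolla us' vs' = corolla xs ys \<otimes>\<^bsub>U\<^esub> corolla xs' ys'"
proof -
  note C = corolla_mult[OF assms(1,2)] and D = corolla_mult[OF assms(3,4)]
  have "map lf (us @ us') @ [hole] @ map lf (vs' @ vs) = map lf (xs @ xs') @ [hole] @ map lf (ys' @ ys)"
    using assms(5,6) by simp
  then show ?thesis
    unfolding C(1) D(1) using assms(1-4)
    by (intro cls_rebracketing[OF rebracketing.intros(1) C(2) D(2)]) simp_all
qed

text \<open>Rebracketing moves the lower vertex away from the hole, onto any \<open>m + 1\<close> consecutive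
  letters to the left of it; scalar contraction then removes that vertex.\<close>

lemma corolla_mult_contract_left:
  assumes "length us + length vs = m" "length us' + length vs' = m"
    and "us @ us' = xs @ ws @ ys" "length ws = m + 1"
  shows "corolla us vs \<otimes>\<^bsub>U\<^esub> corolla us' vs' = corolla (xs @ [tw ws * c] @ ys) (vs' @ vs)"
proof -
  note C = corolla_mult[OF assms(1,2)]
  let ?D = "Vertex (map lf xs @ [Vertex (map lf ws)] @ (map lf ys @ [hole] @ map lf (vs' @ vs)))"
  have len: "length xs + length ws + length ys + length vs' + length vs = 2 * m"
    using arg_cong[OF assms(3), of length] assms(1,2) by simp
  have word: "map lf us @ (map lf us' @ [hole] @ map lf vs') @ map lf vs =
      map lf xs @ map lf ws @ map lf ys @ [hole] @ map lf (vs' @ vs)"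
    using arg_cong[OF assms(3), of "map lf"] by simp
  have D: "?D \<in> contexts (m + 1)"
    using len assms(4) by (auto simp: contexts_def full_tree_Vertex_iff count_list_0_iff)
  have "cls (Vertex (map lf us @ [Vertex (map lf us' @ [hole] @ map lf vs')] @ map lf vs)) = cls ?D"
    using word len assms by (intro cls_rebracketing[OF rebracketing.intros(1) C(2) D]) simp_all
  also have "\<dots> = cls (Vertex (map lf xs @ [lf (tw ws * c)] @ (map lf ys @ [hole] @ map lf (vs' @ vs))))"
    using contraction.intros(1)[OF assms(4), of \<sigma> c, THEN contraction.intros(2)]
    by (intro cls_contraction[OF r_into_rtranclp D]) (simp only: nary_prod_eq[OF assms(4)])
  finally show ?thesis unfolding C(1) by (simp add: corolla_def)
qed

lemma corolla_mult_contract_right: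
  assumes "length us + length vs = m" "length us' + length vs' = m"
    and "vs' @ vs = xs @ ws @ ys" "length ws = m + 1"
  shows "corolla us vs \<otimes>\<^bsub>U\<^esub> corolla us' vs' = corolla (us @ us') (xs @ [tw ws * c] @ ys)"
proof -
  note C = corolla_mult[OF assms(1,2)]
  let ?D = "Vertex ((map lf (us @ us') @ [hole] @ map lf xs) @ [Vertex (map lf ws)] @ map lf ys)"
  have len: "length xs + length ws + length ys + length us' + length us = 2 * m"
    using arg_cong[OF assms(3), of length] assms(1,2) by simp
  have word: "map lf us @ (map lf us' @ [hole] @ map lf vs') @ map lf vs =
      (map lf (us @ us') @ [hole] @ map lf xs) @ map lf ws @ map lf ys"
    using arg_cong[OF assms(3), of "map lf"] by simp
  have D: "?D \<in> contexts (m + 1)"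
    using len assms(4) by (auto simp: contexts_def full_tree_Vertex_iff count_list_0_iff)
  have "cls (Vertex (map lf us @ [Vertex (map lf us' @ [hole] @ map lf vs')] @ map lf vs)) = cls ?D"
    using word len assms by (intro cls_rebracketing[OF rebracketing.intros(1) C(2) D]) simp_all
  also have "\<dots> = cls (Vertex ((map lf (us @ us') @ [hole] @ map lf xs) @ [lf (tw ws * c)] @ map lf ys))"
    using contraction.intros(1)[OF assms(4), of \<sigma> c, THEN contraction.intros(2)]
    by (intro cls_contraction[OF r_into_rtranclp D]) (simp only: nary_prod_eq[OF assms(4)])
  finally show ?thesis unfolding C(1) by (simp add: corolla_def)
qed


section \<open>Relations between the generators\<close>

abbreviation L where "L a \<equiv> cls (L_context m ci a)"
abbreviation R where "R a \<equiv> cls (R_context m ci a)"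
abbreviation S where "S \<equiv> cls (S_context m ci)"

lemma L_eq: "L a = corolla ((a * ci) # replicate (m - 1) 1) []"
  by (simp add: corolla_def L_context_def map_replicate_const)

lemma R_eq: "R b = corolla [] (replicate (m - 1) 1 @ [ci * b])"
  by (simp add: corolla_def R_context_def map_replicate_const)

lemma S_eq: "S = corolla [1] (replicate (m - 2) 1 @ [ci])"
  by (simp add: corolla_def S_context_def map_replicate_const)

lemma m_minus: "m - 1 + 1 = m" "Suc (m - Suc 0) = m" "Suc (Suc (m - 2)) = m"
  using m_ge_2 by simp_all

lemma replicate_m_minus: "replicate (m - 1) x = replicate (m - 2) x @ [x]"
  using m_ge_2 by (simp add: replicate_append_same flip: replicate_Suc)

lemma LRS_carrier [simp]: "L a \<in> carrier U" "R b \<in> carrier U" "S \<in> carrier U"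
  unfolding L_eq R_eq S_eq using m_minus by (intro corolla_carrier; simp)+

lemma anchors: "L 1 = \<one>\<^bsub>U\<^esub>" "R 1 = \<one>\<^bsub>U\<^esub>"
proof -
  have "cls (Vertex ([lf ci] @ replicate (m - 1) (lf 1) @ [hole])) = cls hole"
    using relators_in_I by (intro cls_eqI anchor_contexts hole_in_contexts) (auto simp: anchor_relators_def)
  then show "L 1 = \<one>\<^bsub>U\<^esub>" by (simp add: L_context_def cls_hole)
  have "cls (Vertex ([hole] @ replicate (m - 1) (lf 1) @ [lf ci])) = cls hole"
    using relators_in_I by (intro cls_eqI anchor_contexts hole_in_contexts) (auto simp: anchor_relators_def)
  then show "R 1 = \<one>\<^bsub>U\<^esub>" by (simp add: R_context_def cls_hole)
qed

lemma twisted_prod_ones_between: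
  "j + 1 = m \<Longrightarrow> tw (a # replicate j 1 @ [b]) * c = a * c * b"
  using \<sigma>_pow_m[of b] funpow.simps(2)[of j \<sigma>]
  by (auto simp: twisted_prod_append twisted_prod_ones \<sigma>_one mult.assoc c_inverse)

text \<open>The first \<open>m + 1\<close> letters of the product are \<open>a c\<^sup>-\<^sup>1, 1, \<dots>, 1, u\<close>, which contract to
  \<open>a c\<^sup>-\<^sup>1 \<sigma>\<^sup>m(u) c = a u\<close>.\<close>

lemma L_absorb:
  assumes "length us + length vs + 1 = m"
  shows "L a \<otimes>\<^bsub>U\<^esub> corolla (u # us) vs = corolla ((a * u) # us) vs"
proof -
  have "L a \<otimes>\<^bsub>U\<^esub> corolla (u # us) vs =
      corolla ([] @ [tw ((a * ci) # replicate (m - 1) 1 @ [u]) * c] @ us) (vs @ [])"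
    unfolding L_eq using assms m_minus by (intro corolla_mult_contract_left) simp_all
  then show ?thesis
    unfolding twisted_prod_ones_between[OF m_minus(1)] by (simp add: mult.assoc c_cancel)
qed

lemma R_absorb:
  assumes "length us + length vs + 1 = m"
  shows "R b \<otimes>\<^bsub>U\<^esub> corolla us (vs @ [v]) = corolla us (vs @ [v * b])"
proof -
  have "R b \<otimes>\<^bsub>U\<^esub> corolla us (vs @ [v]) =
      corolla ([] @ us) (vs @ [tw (v # replicate (m - 1) 1 @ [ci * b]) * c] @ [])"
    unfolding R_eq using assms m_minus by (intro corolla_mult_contract_right) simp_all
  then show ?thesis
    unfolding twisted_prod_ones_between[OF m_minus(1)] by (simp add: mult.assoc c_cancel)
qed

lemma L_mult: "L a \<otimes>\<^bsub>U\<^esub> L b = L (a * b)"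
  unfolding L_eq[of b] L_eq[of "a * b"] by (simp add: L_absorb m_minus mult.assoc)

lemma R_mult: "R a \<otimes>\<^bsub>U\<^esub> R b = R (b * a)"
  unfolding R_eq[of b] R_eq[of "b * a"] by (simp add: R_absorb m_minus mult.assoc)

lemma R_L_commute: "R b \<otimes>\<^bsub>U\<^esub> L a = L a \<otimes>\<^bsub>U\<^esub> R b"
  unfolding L_eq R_eq using m_minus by (intro corolla_mult_regraft) simp_all

text \<open>The first \<open>m + 1\<close> letters, up to the hole of the inner corolla, form one window; its value
  \<open>\<sigma> a\<close> is then absorbed back out of the first input of \<open>S\<close>.\<close>

lemma S_L: "S \<otimes>\<^bsub>U\<^esub> L a = L (\<sigma> a) \<otimes>\<^bsub>U\<^esub> S"
proof -
  have "S \<otimes>\<^bsub>U\<^esub> L a = corolla ([] @ [tw (1 # (a * ci) # replicate (m - 1) 1) * c] @ []) ([] @ replicate (m - 2) 1 @ [ci])"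
    unfolding S_eq L_eq using m_minus by (intro corolla_mult_contract_left) simp_all
  also have "\<dots> = corolla [\<sigma> a] (replicate (m - 2) 1 @ [ci])"
    by (simp add: twisted_prod_ones \<sigma>_one \<sigma>_mult \<sigma>_ci mult.assoc c_inverse)
  also have "\<dots> = L (\<sigma> a) \<otimes>\<^bsub>U\<^esub> S"
    unfolding S_eq by (simp add: L_absorb m_minus)
  finally show ?thesis .
qed

lemma S_R: "S \<otimes>\<^bsub>U\<^esub> R b = R (\<sigma> b) \<otimes>\<^bsub>U\<^esub> S"
proof -
  have "S \<otimes>\<^bsub>U\<^esub> R b = corolla ([1] @ []) (replicate (m - 2) 1 @ [tw (1 # ((ci * b) # replicate (m - 2) 1 @ [ci])) * c] @ [])"
    unfolding S_eq R_eq replicate_m_minus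
    by (intro corolla_mult_contract_right) (simp_all add: m_minus)
  also have "\<dots> = corolla [1] (replicate (m - 2) 1 @ [ci * \<sigma> b])"
    by (simp add: twisted_prod_append twisted_prod_ones funpow_\<sigma> \<sigma>_one \<sigma>_mult \<sigma>_ci mult.assoc c_inverse)
  also have "\<dots> = R (\<sigma> b) \<otimes>\<^bsub>U\<^esub> S"
    unfolding S_eq by (simp add: R_absorb m_minus)
  finally show ?thesis .
qed

text \<open>This is where the anchors do their work. A word with at most one letter is its own twisted product, so
  let \<open>us\<close> be longer. Multiplication by \<open>L 1\<close>, the unit, puts the letters
  \<open>c\<^sup>-\<^sup>1, 1, \<dots>, 1\<close> in front of \<open>us\<close>. The window of \<open>m + 1\<close> letters that ends at the hole then contains
  all of \<open>us\<close> and otherwise only ones, so contracting it leaves a corolla that knows \<open>us\<close> only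
  through its twisted product.\<close>

lemma corolla_left_twisted_prod:
  assumes "length us + length vs = m" "length us' = length us" "tw us' = tw us"
  shows "corolla us' vs = corolla us vs"
proof (cases "length us \<le> 1")
  case True
  then have "us' = us"
    using assms(2,3) by (cases us; cases us') (auto simp: \<sigma>_one)
  then show ?thesis by simp
next
  case False
  let ?p = "length us"
  have shape: "corolla ws vs = corolla (([ci] @ replicate (?p - 2) 1) @ [(\<sigma> ^^ (m - ?p + 1)) (tw ws) * c] @ []) (vs @ [])"
    if len: "length ws = ?p" for ws
  proof -
    have eq: "(ci # replicate (m - 1) 1) @ ws = ([ci] @ replicate (?p - 2) 1) @ (replicate (m - ?p + 1) 1 @ ws) @ []"
    proof -
      have "m - 1 = (?p - 2) + (m - ?p + 1)" using False assms(1) by arith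
      then show ?thesis by (simp only: replicate_add) simp
    qed
    have "corolla ws vs = L 1 \<otimes>\<^bsub>U\<^esub> corolla ws vs"
      using corolla_carrier[of ws vs] assms(1) len by (simp add: anchors)
    also have "\<dots> = corolla (([ci] @ replicate (?p - 2) 1) @ [tw (replicate (m - ?p + 1) 1 @ ws) * c] @ []) (vs @ [])"
      unfolding L_eq using eq assms(1) len m_minus False
      by (intro corolla_mult_contract_left) simp_all
    finally show ?thesis
      unfolding twisted_prod_append twisted_prod_ones length_replicate mult_1_left .
  qed
  show ?thesis
    using shape[OF assms(2)] shape[of us] assms(3) by simp
qed

lemma corolla_right_twisted_prod:
  assumes "length us + length vs = m" "length vs' = length vs" "tw vs' = tw vs"
  shows "corolla us vs' = corolla us vs"
proof (cases "length vs \<le> 1")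
  case True
  then have "vs' = vs"
    using assms(2,3) by (cases vs; cases vs') (auto simp: \<sigma>_one)
  then show ?thesis by simp
next
  case False
  let ?p = "length vs"
  have shape: "corolla us ws = corolla ([] @ us) ([] @ [tw ws * c] @ (replicate (?p - 2) 1 @ [ci]))"
    if len: "length ws = ?p" for ws
  proof -
    have eq: "ws @ (replicate (m - 1) 1 @ [ci]) = [] @ (ws @ replicate (m - ?p + 1) 1) @ (replicate (?p - 2) 1 @ [ci])"
    proof -
      have "m - 1 = (m - ?p + 1) + (?p - 2)" using False assms(1) by arith
      then show ?thesis by (simp only: replicate_add) simp
    qed
    have "corolla us ws = R 1 \<otimes>\<^bsub>U\<^esub> corolla us ws"
      using corolla_carrier[of us ws] assms(1) len by (simp add: anchors)
    also have "\<dots> = corolla ([] @ us) ([] @ [tw (ws @ replicate (m - ?p + 1) 1) * c] @ (replicate (?p - 2) 1 @ [ci]))"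
      unfolding R_eq using eq assms(1) len m_minus False
      by (intro corolla_mult_contract_right) simp_all
    finally show ?thesis
      unfolding twisted_prod_append twisted_prod_ones funpow_\<sigma> mult_1_right .
  qed
  show ?thesis
    using shape[OF assms(2)] shape[of vs] assms(3) by simp
qed

text \<open>Since only the twisted product of \<open>us\<close> matters, \<open>us\<close> may be replaced by a word concentrated in its first letter, which
  \<open>L\<close> absorbs.\<close>

lemma corolla_pull_left:
  assumes "length us + length vs = m"
  shows "corolla us vs = L (tw us) \<otimes>\<^bsub>U\<^esub> corolla (replicate (length us) 1) vs"
proof (cases us)
  case Nil
  then show ?thesis using assms corolla_carrier[of us vs] by (simp add: anchors)
next
  case (Cons u us')
  have "corolla us vs = corolla (tw us # replicate (length us') 1) vs"
    using assms by (intro corolla_left_twisted_prod[symmetric]) (simp_all add: Cons twisted_prod_ones \<sigma>_one)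
  also have "\<dots> = L (tw us) \<otimes>\<^bsub>U\<^esub> corolla (1 # replicate (length us') 1) vs"
    using assms by (subst L_absorb) (simp_all add: Cons)
  finally show ?thesis by (simp add: Cons)
qed

text \<open>Here \<open>vs'\<close> is replaced by a word concentrated in its last letter, where \<open>R\<close> absorbs. A letter at distance \<open>j\<close>
  from the hole enters the twisted product under \<open>\<sigma> ^^ (j - 1)\<close>, and since \<open>\<sigma> ^^ m\<close> is conjugation by
  \<open>c\<close>, inverting that power amounts to applying the complementary one; this is where the exponent
  \<open>Suc (length us)\<close> and the factor \<open>c\<close> come from.\<close>

lemma corolla_pull_right:
  assumes "length us + length vs + 1 = m" "length vs' = length vs + 1"
  shows "corolla us vs' = R ((\<sigma> ^^ Suc (length us)) (tw vs') * c) \<otimes>\<^bsub>U\<^esub> corolla us (replicate (length vs) 1 @ [ci])"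
proof -
  let ?b = "(\<sigma> ^^ Suc (length us)) (tw vs') * c"
  have "(\<sigma> ^^ length vs) ?b = (\<sigma> ^^ m) (tw vs') * c"
    using assms(1) funpow_add[of "length vs" "Suc (length us)" \<sigma>]
    by (simp add: funpow_\<sigma> add.commute)
  then have "tw (replicate (length vs) 1 @ [ci * ?b]) = tw vs'"
    unfolding twisted_prod_append twisted_prod_ones length_replicate twisted_prod.simps \<sigma>_one
      mult_1_left mult_1_right funpow_\<sigma>(4)[of _ ci]
    by (simp add: funpow_\<sigma>(3) \<sigma>_pow_m mult.assoc c_inverse c_cancel)
  then have "corolla us vs' = corolla us (replicate (length vs) 1 @ [ci * ?b])"
    using assms by (intro corolla_right_twisted_prod) simp_all
  also have "\<dots> = R ?b \<otimes>\<^bsub>U\<^esub> corolla us (replicate (length vs) 1 @ [ci])"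
    using assms by (subst R_absorb) simp_all
  finally show ?thesis .
qed

text \<open>Up to exponent \<open>m - 1\<close>, multiplication by \<open>S\<close> moves the hole by one input: the contracted window is
  \<open>1, c\<^sup>-\<^sup>1, 1, \<dots>, 1, c\<^sup>-\<^sup>1\<close>, with value \<open>c\<^sup>-\<^sup>1\<close>.\<close>

lemma S_pow_eq: "p + j + 1 = m \<Longrightarrow> S [^]\<^bsub>U\<^esub> p = corolla (replicate p 1) (replicate j 1 @ [ci])"
proof (induction p arbitrary: j)
  case 0
  then have "j = m - 1" by simp
  then show ?case using anchors(2) by (simp add: R_eq)
next
  case (Suc p)
  have eq: "(replicate (Suc j) 1 @ [ci]) @ (replicate (m - 2) 1 @ [ci]) =
      replicate j 1 @ (1 # ci # replicate (m - 2) 1 @ [ci]) @ []"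
    using replicate_add[of j 1 "1::'a"] by simp
  have "S [^]\<^bsub>U\<^esub> Suc p = S \<otimes>\<^bsub>U\<^esub> S [^]\<^bsub>U\<^esub> p"
    by (rule U.nat_pow_Suc2) simp
  also have "\<dots> = corolla [1] (replicate (m - 2) 1 @ [ci]) \<otimes>\<^bsub>U\<^esub> corolla (replicate p 1) (replicate (Suc j) 1 @ [ci])"
    using Suc.IH[of "Suc j"] Suc.prems by (simp add: S_eq)
  also have "\<dots> = corolla ([1] @ replicate p 1) (replicate j 1 @ [tw (1 # ci # replicate (m - 2) 1 @ [ci]) * c] @ [])"
    using eq Suc.prems m_minus by (intro corolla_mult_contract_right) simp_all
  also have "\<dots> = corolla (replicate (Suc p) 1) (replicate j 1 @ [ci])"
    by (simp add: twisted_prod_append twisted_prod_ones funpow_\<sigma> \<sigma>_one \<sigma>_mult \<sigma>_ci mult.assoc c_inverse)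
  finally show ?case .
qed

text \<open>The step after the last input: the hole of \<open>S\<^sup>m\<close> would leave the vertex, and regrafting turns the product into
  one of a corolla with the hole first and one with the hole last. This lifts the identity
  \<open>\<sigma>\<^sup>m(a) = c a c\<^sup>-\<^sup>1\<close> from the regular module to the anchored algebra.\<close>

lemma S_pow_m: "S [^]\<^bsub>U\<^esub> m = L c \<otimes>\<^bsub>U\<^esub> R ci"
proof -
  have "S [^]\<^bsub>U\<^esub> m = S \<otimes>\<^bsub>U\<^esub> S [^]\<^bsub>U\<^esub> (m - 1)"
    using U.nat_pow_Suc2[of S "m - 1"] m_minus by simp
  also have "\<dots> = corolla [1] (replicate (m - 2) 1 @ [ci]) \<otimes>\<^bsub>U\<^esub> corolla (replicate (m - 1) 1) [ci]"
    using S_pow_eq[of "m - 1" 0] m_ge_2 by (simp add: S_eq)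
  also have "\<dots> = corolla [] (ci # replicate (m - 2) 1 @ [ci]) \<otimes>\<^bsub>U\<^esub> corolla (replicate m 1) []"
    using m_minus replicate_Suc[of "m - 1" "1::'a"]
    by (intro corolla_mult_regraft) simp_all
  also have "corolla (replicate m 1) [] = L c"
    using replicate_Suc[of "m - 1" "1::'a"] m_minus by (simp add: L_eq c_inverse)
  also have "corolla [] (ci # replicate (m - 2) 1 @ [ci]) = R ci"
    using corolla_pull_right[of "[]" "replicate (m - 1) 1" "ci # replicate (m - 2) 1 @ [ci]"] m_minus
      anchors(2) R_eq[of 1]
    by (simp add: twisted_prod_append twisted_prod_ones funpow_\<sigma> \<sigma>_one \<sigma>_mult \<sigma>_ci mult.assoc c_inverse)
  finally show ?thesis by (simp add: R_L_commute)
qed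

lemma L_R_mult:
  "(L a \<otimes>\<^bsub>U\<^esub> R b) \<otimes>\<^bsub>U\<^esub> (L a' \<otimes>\<^bsub>U\<^esub> R b') = L (a * a') \<otimes>\<^bsub>U\<^esub> R (b' * b)"
proof -
  have "(L a \<otimes>\<^bsub>U\<^esub> R b) \<otimes>\<^bsub>U\<^esub> (L a' \<otimes>\<^bsub>U\<^esub> R b') = L a \<otimes>\<^bsub>U\<^esub> (R b \<otimes>\<^bsub>U\<^esub> L a') \<otimes>\<^bsub>U\<^esub> R b'"
    by (simp add: U.m_assoc)
  also have "\<dots> = (L a \<otimes>\<^bsub>U\<^esub> L a') \<otimes>\<^bsub>U\<^esub> (R b \<otimes>\<^bsub>U\<^esub> R b')"
    unfolding R_L_commute by (simp add: U.m_assoc)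
  finally show ?thesis by (simp add: L_mult R_mult)
qed

lemma S_pow_L_R: "S [^]\<^bsub>U\<^esub> (j::nat) \<otimes>\<^bsub>U\<^esub> (L a \<otimes>\<^bsub>U\<^esub> R b) =
    L ((\<sigma> ^^ j) a) \<otimes>\<^bsub>U\<^esub> R ((\<sigma> ^^ j) b) \<otimes>\<^bsub>U\<^esub> S [^]\<^bsub>U\<^esub> j"
proof (induction j arbitrary: a b)
  case (Suc j)
  have "S [^]\<^bsub>U\<^esub> Suc j \<otimes>\<^bsub>U\<^esub> (L a \<otimes>\<^bsub>U\<^esub> R b) = S [^]\<^bsub>U\<^esub> j \<otimes>\<^bsub>U\<^esub> ((S \<otimes>\<^bsub>U\<^esub> L a) \<otimes>\<^bsub>U\<^esub> R b)"
    by (simp add: U.m_assoc)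
  also have "(S \<otimes>\<^bsub>U\<^esub> L a) \<otimes>\<^bsub>U\<^esub> R b = L (\<sigma> a) \<otimes>\<^bsub>U\<^esub> (S \<otimes>\<^bsub>U\<^esub> R b)"
    unfolding S_L by (simp add: U.m_assoc)
  also have "\<dots> = (L (\<sigma> a) \<otimes>\<^bsub>U\<^esub> R (\<sigma> b)) \<otimes>\<^bsub>U\<^esub> S"
    unfolding S_R by (simp add: U.m_assoc)
  also have "S [^]\<^bsub>U\<^esub> j \<otimes>\<^bsub>U\<^esub> \<dots> = (S [^]\<^bsub>U\<^esub> j \<otimes>\<^bsub>U\<^esub> (L (\<sigma> a) \<otimes>\<^bsub>U\<^esub> R (\<sigma> b))) \<otimes>\<^bsub>U\<^esub> S"
    by (simp add: U.m_assoc)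
  finally show ?case
    unfolding Suc by (simp add: U.m_assoc funpow_swap1)
qed simp

lemma S_pow_mult_m: "S [^]\<^bsub>U\<^esub> (j * m) = L (c ^ j) \<otimes>\<^bsub>U\<^esub> R (ci ^ j)"
proof (induction j)
  case 0
  show ?case by (simp add: anchors)
next
  case (Suc j)
  have "S [^]\<^bsub>U\<^esub> (Suc j * m) = S [^]\<^bsub>U\<^esub> m \<otimes>\<^bsub>U\<^esub> S [^]\<^bsub>U\<^esub> (j * m)"
    by (simp add: U.nat_pow_mult)
  also have "\<dots> = L (c * c ^ j) \<otimes>\<^bsub>U\<^esub> R (ci ^ j * ci)"
    unfolding Suc S_pow_m by (rule L_R_mult)
  finally show ?case by (simp add: power_commutes)
qed

text \<open>The division of the hole position by \<open>m\<close>: it accounts for the factors \<open>c ^ t\<close> and \<open>ci ^ t\<close>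
  in the normal form. Stating the normal form with the unreduced power of \<open>S\<close> first keeps the induction
  over trees free of any case distinction on carries.\<close>

lemma L_R_S_pow_reduce:
  "L a \<otimes>\<^bsub>U\<^esub> R b \<otimes>\<^bsub>U\<^esub> S [^]\<^bsub>U\<^esub> (j * m + i) =
    L (a * c ^ j) \<otimes>\<^bsub>U\<^esub> R (ci ^ j * b) \<otimes>\<^bsub>U\<^esub> S [^]\<^bsub>U\<^esub> i"
proof -
  have "L a \<otimes>\<^bsub>U\<^esub> R b \<otimes>\<^bsub>U\<^esub> S [^]\<^bsub>U\<^esub> (j * m + i) =
      (L a \<otimes>\<^bsub>U\<^esub> R b) \<otimes>\<^bsub>U\<^esub> S [^]\<^bsub>U\<^esub> (j * m) \<otimes>\<^bsub>U\<^esub> S [^]\<^bsub>U\<^esub> i"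
    by (simp add: U.nat_pow_mult[symmetric] U.m_assoc)
  then show ?thesis unfolding S_pow_mult_m L_R_mult .
qed

lemma L_R_S_pow_mult:
  fixes i j :: nat
  shows "(L a \<otimes>\<^bsub>U\<^esub> R b \<otimes>\<^bsub>U\<^esub> S [^]\<^bsub>U\<^esub> i) \<otimes>\<^bsub>U\<^esub> (L a' \<otimes>\<^bsub>U\<^esub> R b' \<otimes>\<^bsub>U\<^esub> S [^]\<^bsub>U\<^esub> j) =
    L (a * (\<sigma> ^^ i) a') \<otimes>\<^bsub>U\<^esub> R ((\<sigma> ^^ i) b' * b) \<otimes>\<^bsub>U\<^esub> S [^]\<^bsub>U\<^esub> (i + j)"
proof -
  have "(L a \<otimes>\<^bsub>U\<^esub> R b \<otimes>\<^bsub>U\<^esub> S [^]\<^bsub>U\<^esub> i) \<otimes>\<^bsub>U\<^esub> (L a' \<otimes>\<^bsub>U\<^esub> R b' \<otimes>\<^bsub>U\<^esub> S [^]\<^bsub>U\<^esub> j) =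
      (L a \<otimes>\<^bsub>U\<^esub> R b) \<otimes>\<^bsub>U\<^esub> (S [^]\<^bsub>U\<^esub> i \<otimes>\<^bsub>U\<^esub> (L a' \<otimes>\<^bsub>U\<^esub> R b')) \<otimes>\<^bsub>U\<^esub> S [^]\<^bsub>U\<^esub> j"
    by (simp add: U.m_assoc)
  also have "\<dots> = ((L a \<otimes>\<^bsub>U\<^esub> R b) \<otimes>\<^bsub>U\<^esub> (L ((\<sigma> ^^ i) a') \<otimes>\<^bsub>U\<^esub> R ((\<sigma> ^^ i) b'))) \<otimes>\<^bsub>U\<^esub> (S [^]\<^bsub>U\<^esub> i \<otimes>\<^bsub>U\<^esub> S [^]\<^bsub>U\<^esub> j)"
    unfolding S_pow_L_R by (simp add: U.m_assoc)
  finally show ?thesis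
    unfolding L_R_mult by (simp add: U.nat_pow_mult)
qed

text \<open>For the hole in the last input the power of \<open>S\<close> is \<open>S\<^sup>m\<close>, out of reach of moving the hole inside
  one vertex; there the corolla is an \<open>L\<close> outright, and the formula comes from undoing the reduction
  of \<open>S\<^sup>m\<close>.\<close>

lemma corolla_eq_L_R_S:
  assumes "length us + length vs = m"
  shows "corolla us vs = L (tw us) \<otimes>\<^bsub>U\<^esub> R ((\<sigma> ^^ Suc (length us)) (tw vs) * c) \<otimes>\<^bsub>U\<^esub> S [^]\<^bsub>U\<^esub> length us"
proof (cases vs rule: rev_cases)
  case Nil
  have "corolla (replicate m 1) [] = L c"
    using replicate_Suc[of "m - 1" "1::'a"] m_minus by (simp add: L_eq c_inverse)
  then have "corolla us vs = L (tw us * c)"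
    using corolla_pull_left[OF assms] assms Nil by (simp add: L_mult)
  also have "\<dots> = L (tw us * c ^ 1) \<otimes>\<^bsub>U\<^esub> R (ci ^ 1 * c) \<otimes>\<^bsub>U\<^esub> S [^]\<^bsub>U\<^esub> (0::nat)"
    by (simp add: c_inverse anchors)
  also have "\<dots> = L (tw us) \<otimes>\<^bsub>U\<^esub> R c \<otimes>\<^bsub>U\<^esub> S [^]\<^bsub>U\<^esub> (1 * m + 0)"
    by (rule L_R_S_pow_reduce[symmetric])
  finally show ?thesis using assms Nil funpow_\<sigma>(1)[of "Suc m"] by simp
next
  case (snoc vs' v)
  let ?V = "corolla (replicate (length us) 1) (replicate (length vs') 1 @ [ci])"
  have "corolla us vs = L (tw us) \<otimes>\<^bsub>U\<^esub> (R ((\<sigma> ^^ Suc (length us)) (tw vs) * c) \<otimes>\<^bsub>U\<^esub> ?V)"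
    using corolla_pull_left[OF assms] corolla_pull_right[of "replicate (length us) 1" vs' vs] assms snoc
    by simp
  also have "?V = S [^]\<^bsub>U\<^esub> length us"
    using S_pow_eq[of "length us" "length vs'"] assms snoc by simp
  finally show ?thesis by (simp add: U.m_assoc)
qed


section \<open>The normal form of a context\<close>

text \<open>Induction along the path from the root to the hole. The ordinary subtrees at the root contract to leaves,
  so the context is a corolla times the subtree containing the hole, and both factors are in normal form
  already. What remains is a computation with exponents: the \<open>v\<close> vertices to the left of the hole shift
  everything after them by \<open>\<sigma> ^^ (v * m)\<close>, which is conjugation by \<open>c ^ v\<close>, and the same powers of
  \<open>c\<close> come out of reducing the exponent of \<open>S\<close>.\<close>

lemma context_normal_form:
  assumes "C \<in> contexts (m + 1)" "leaves C = map Some us @ None # map Some vs"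
  shows "cls C = L (tw us) \<otimes>\<^bsub>U\<^esub> R ((\<sigma> ^^ Suc (length us)) (tw vs) * c ^ num_vertices C)
    \<otimes>\<^bsub>U\<^esub> S [^]\<^bsub>U\<^esub> length us"
  using assms
proof (induction C arbitrary: us vs)
  case (Leaf l)
  then have "us = []" "vs = []" "l = None"
    by (auto simp: Cons_eq_append_conv)
  then show ?case by (simp add: \<sigma>_one anchors cls_hole)
next
  case (Vertex ts)
  have full: "length ts = m + 1" "\<And>t. t \<in> set ts \<Longrightarrow> full_tree (m + 1) t"
    and count: "count_list (concat (map leaves ts)) None = 1"
    using Vertex.prems(1) by (simp_all add: contexts_def full_tree_Vertex_iff)
  have "None \<in> set (concat (map leaves ts))"
    using count by (metis count_notin zero_neq_one)
  then obtain D where "D \<in> set ts" "None \<in> set (leaves D)" by auto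
  then obtain xs0 ys0 where ts0: "ts = xs0 @ D # ys0" by (meson split_list)
  have counts: "count_list (concat (map leaves xs0)) None = 0" "count_list (leaves D) None = 1"
    "count_list (concat (map leaves ys0)) None = 0"
  proof -
    have "count_list (leaves D) None \<noteq> 0"
      using \<open>None \<in> set (leaves D)\<close> by (simp add: count_list_0_iff)
    then show "count_list (concat (map leaves xs0)) None = 0" "count_list (leaves D) None = 1"
      "count_list (concat (map leaves ys0)) None = 0"
      using count by (simp_all add: ts0)
  qed
  obtain xs where xs: "xs0 = map (map_ptree Some) xs"
    using counts(1) ordinary_forest[of xs0] by (auto simp: count_list_0_iff)
  obtain ys where ys: "ys0 = map (map_ptree Some) ys"
    using counts(3) ordinary_forest[of ys0] by (auto simp: count_list_0_iff)
  obtain us' vs' where D_leaves: "leaves D = map Some us' @ None # map Some vs'"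
    using counts(2) context_leaves by blast
  note ts = ts0[unfolded xs ys]
  have D: "D \<in> contexts (m + 1)"
    using full(2) counts(2) by (simp add: contexts_def ts)
  \<comment> \<open>\<open>X\<close> and \<open>Y\<close> are the leaf words contributed by the ordinary subtrees on the two sides.\<close>
  define X where "X = concat (map leaves xs)"
  define Y where "Y = concat (map leaves ys)"
  let ?xs = "map (eval_tree m \<sigma> c) xs" and ?ys = "map (eval_tree m \<sigma> c) ys"
  let ?v = "sum_list (map num_vertices xs)" and ?w = "sum_list (map num_vertices ys)"
    and ?d = "num_vertices D" and ?p = "length xs" and ?h = "length us'"
  have len: "length ?xs + length ?ys = m" using full(1) by (simp add: ts)
  have full_xy: "full_tree (m + 1) t" if "t \<in> set xs \<union> set ys" for t
    using that full(2)[of "map_ptree Some t"] by (auto simp: ts)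
  have contract: "(contraction m \<sigma> c)\<^sup>*\<^sup>* (map_ptree Some t) (lf (eval_tree m \<sigma> c t))"
    if "t \<in> set xs \<union> set ys" for t
    using that by (intro contract_ordinary_tree full_xy)
  have evX: "tw ?xs = tw X * c ^ ?v" "length X = ?v * m + ?p"
    using eval_forest_eq[of xs] eval_tree_eq_and_length full_xy by (simp_all add: X_def)
  have evY: "tw ?ys = tw Y * c ^ ?w" "length Y = ?w * m + length ys"
    using eval_forest_eq[of ys] eval_tree_eq_and_length full_xy by (simp_all add: Y_def)
  have lenD: "?h + 1 + length vs' = ?d * m + 1"
    using eval_tree_eq_and_length[of "map_ptree the D"] D D_leaves
    by (simp add: contexts_def leaves_map_ptree)

  have "map Some us @ None # map Some vs = map Some (X @ us') @ None # map Some (vs' @ Y)"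
    using Vertex.prems(2) D_leaves
    by (simp add: ts X_def Y_def leaves_map_ptree comp_def map_concat)
  from around_hole_unique[OF this] have us: "us = X @ us'" and vs: "vs = vs' @ Y"
    by simp_all
  have num: "num_vertices (Vertex ts) = 1 + ?v + ?d + ?w"
    by (simp add: ts comp_def)

  have "cls (Vertex ts) = cls (Vertex (map lf ?xs @ [D] @ map lf ?ys))"
  proof (rule cls_contraction[OF _ Vertex.prems(1)])
    have "(contraction m \<sigma> c)\<^sup>*\<^sup>* (Vertex ts) (Vertex (map lf ?xs @ D # map (map_ptree Some) ys))"
      using contractions_in_forest[of xs m \<sigma> c "map_ptree Some" "\<lambda>t. lf (eval_tree m \<sigma> c t)" "[]"
          "D # map (map_ptree Some) ys"] contract
      by (simp add: ts comp_def)
    moreover have "(contraction m \<sigma> c)\<^sup>*\<^sup>* (Vertex (map lf ?xs @ D # map (map_ptree Some) ys))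
        (Vertex (map lf ?xs @ [D] @ map lf ?ys))"
      using contractions_in_forest[of ys m \<sigma> c "map_ptree Some" "\<lambda>t. lf (eval_tree m \<sigma> c t)"
          "map lf ?xs @ [D]" "[]"] contract
      by (simp add: comp_def)
    ultimately show "(contraction m \<sigma> c)\<^sup>*\<^sup>* (Vertex ts) (Vertex (map lf ?xs @ [D] @ map lf ?ys))"
      by (rule rtranclp_trans)
  qed
  also have "\<dots> = cls (graft (Vertex (map lf ?xs @ [hole] @ map lf ?ys)) D)"
    by (simp add: comp_def)
  also have "\<dots> = corolla ?xs ?ys \<otimes>\<^bsub>U\<^esub> cls D"
    unfolding corolla_def using len by (intro cls_graft D) (simp only: one_vertex_in_contexts)
  also have "\<dots> = L (tw ?xs * (\<sigma> ^^ ?p) (tw us')) \<otimes>\<^bsub>U\<^esub>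
      R ((\<sigma> ^^ ?p) ((\<sigma> ^^ Suc ?h) (tw vs') * c ^ ?d) * ((\<sigma> ^^ Suc ?p) (tw ?ys) * c)) \<otimes>\<^bsub>U\<^esub>
      S [^]\<^bsub>U\<^esub> (?p + ?h)"
    unfolding corolla_eq_L_R_S[OF len] length_map
    using Vertex.IH[of D, OF _ D D_leaves] ts by (simp add: L_R_S_pow_mult del: funpow.simps)
  also have "tw ?xs * (\<sigma> ^^ ?p) (tw us') = tw us * c ^ ?v"
    using funpow_\<sigma>_m[of ?v]
    by (simp add: us twisted_prod_append evX funpow_add mult.assoc power_cancel)
  also have "(\<sigma> ^^ ?p) ((\<sigma> ^^ Suc ?h) (tw vs') * c ^ ?d) * ((\<sigma> ^^ Suc ?p) (tw ?ys) * c) =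
      ci ^ ?v * ((\<sigma> ^^ Suc (length us)) (tw vs) * c ^ num_vertices (Vertex ts))"
  proof -
    \<comment> \<open>The subtree \<open>D\<close> has \<open>d * m + 1\<close> leaves, so the word \<open>Y\<close> behind it is shifted by a further
      \<open>\<sigma> ^^ (d * m)\<close>, which is conjugation by \<open>c ^ d\<close>.\<close>
    let ?Y = "(\<sigma> ^^ Suc ?p) (tw Y)"
    have join: "(\<sigma> ^^ i) ((\<sigma> ^^ j) a) = (\<sigma> ^^ (i + j)) a" for i j a
      by (simp add: funpow_add)
    have "?p + Suc ?h + length vs' = ?d * m + Suc ?p"
      using lenD by simp
    then have "(\<sigma> ^^ (?p + Suc ?h)) ((\<sigma> ^^ length vs') (tw Y)) = (\<sigma> ^^ (?d * m)) ?Y"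
      by (simp only: join)
    also have "\<dots> = c ^ ?d * ?Y * ci ^ ?d"
      by (rule funpow_\<sigma>_m)
    finally have tail: "(\<sigma> ^^ (?p + Suc ?h)) (tw vs) =
        (\<sigma> ^^ ?p) ((\<sigma> ^^ Suc ?h) (tw vs')) * (c ^ ?d * ?Y * ci ^ ?d)"
      by (simp only: vs twisted_prod_append funpow_\<sigma> join)
    have "Suc (length us) = ?v * m + (?p + Suc ?h)"
      by (simp add: us evX)
    then have "(\<sigma> ^^ Suc (length us)) (tw vs) = c ^ ?v * (\<sigma> ^^ (?p + Suc ?h)) (tw vs) * ci ^ ?v"
      by (simp only: join[symmetric] funpow_\<sigma>_m)
    moreover have "c ^ num_vertices (Vertex ts) = c ^ ?v * (c ^ ?d * (c ^ ?w * c))"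
    proof -
      have "num_vertices (Vertex ts) = ?v + (?d + (?w + 1))" unfolding num by simp
      then show ?thesis by (simp only: power_add power_one_right)
    qed
    ultimately have "ci ^ ?v * ((\<sigma> ^^ Suc (length us)) (tw vs) * c ^ num_vertices (Vertex ts)) =
        (\<sigma> ^^ ?p) ((\<sigma> ^^ Suc ?h) (tw vs')) * (c ^ ?d * (?Y * (c ^ ?w * c)))"
      by (simp only: tail mult.assoc power_cancel_left)
    then show ?thesis
      by (simp only: funpow_\<sigma> evY mult.assoc)
  qed
  also have "L (tw us * c ^ ?v) \<otimes>\<^bsub>U\<^esub>
      R (ci ^ ?v * ((\<sigma> ^^ Suc (length us)) (tw vs) * c ^ num_vertices (Vertex ts))) \<otimes>\<^bsub>U\<^esub>
      S [^]\<^bsub>U\<^esub> (?p + ?h) =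
    L (tw us) \<otimes>\<^bsub>U\<^esub> R ((\<sigma> ^^ Suc (length us)) (tw vs) * c ^ num_vertices (Vertex ts)) \<otimes>\<^bsub>U\<^esub>
      S [^]\<^bsub>U\<^esub> length us"
    using L_R_S_pow_reduce[of _ _ ?v "?p + ?h"] by (simp add: us evX add.assoc)
  finally show ?case .
qed

end


theorem lemma3p2:
  fixes scale :: "'k::{comm_ring,comm_monoid_mult} \<Rightarrow> 'a::{ring,monoid_mult} \<Rightarrow> 'a"
    and \<sigma> :: "'a \<Rightarrow> 'a" and c ci :: 'a and m q h t r :: nat
    and C :: "'a option ptree" and x :: "nat \<Rightarrow> 'a"
  defines "U \<equiv> anchored_algebra m scale \<sigma> c ci"
    and "cls \<equiv> context_class m scale \<sigma> c ci"
    and "act \<equiv> regular_act m scale \<sigma> c"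
    and "P \<equiv> prod_list (map (\<lambda>j. (\<sigma> ^^ j) (x j)) [0..<h])"
    and "Q \<equiv> prod_list (map (\<lambda>j. (\<sigma> ^^ j) (x j)) [Suc h..<Suc (q * m)])"
  defines "aC \<equiv> P * c ^ t"
    and "bC \<equiv> ci ^ t * Q * c ^ q"
  defines "L \<equiv> cls (L_context m ci aC)"
    and "R \<equiv> cls (R_context m ci bC)"
    and "S \<equiv> cls (S_context m ci)"
  assumes "twisted_datum scale m \<sigma> c ci"
    and "C \<in> contexts (m + 1)"
    and "q = num_vertices C"
    and "leaves C = map (\<lambda>j. if j = h then None else Some (x j)) [0..<Suc (q * m)]"
    and "h = t * m + r" and "r < m"
  shows "cls C = L \<otimes>\<^bsub>U\<^esub> R \<otimes>\<^bsub>U\<^esub> S [^]\<^bsub>U\<^esub> r \<and>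
    (\<forall>y. act S y = \<sigma> y) \<and>
    (\<forall>y. act (L \<otimes>\<^bsub>U\<^esub> R \<otimes>\<^bsub>U\<^esub> S [^]\<^bsub>U\<^esub> r) y = aC * (act S ^^ r) y * bC) \<and>
    (\<forall>y. aC * (act S ^^ r) y * bC = P * (\<sigma> ^^ h) y * Q * c ^ q)"
proof -
  interpret T: twisted_datum scale m \<sigma> c ci by fact
  let ?us = "map x [0..<h]" and ?vs = "map x [Suc h..<Suc (q * m)]"
  have full: "full_tree (m + 1) C" and hole: "count_list (leaves C) None = 1"
    using assms(12) by (simp_all add: contexts_def)
  have "h < Suc (q * m)"
  proof (rule ccontr)
    assume "\<not> h < Suc (q * m)"
    then have "None \<notin> set (leaves C)" using assms(14) by auto
    then show False using hole by (simp add: count_list_0_iff[symmetric])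
  qed
  then have "[0..<Suc (q * m)] = [0..<h] @ h # [Suc h..<Suc (q * m)]"
    using upt_add_eq_append[of 0 h "Suc (q * m) - h"] upt_conv_Cons by simp
  then have leaves: "leaves C = map Some ?us @ None # map Some ?vs"
    unfolding assms(14) by (simp del: upt_Suc)
  have P: "P = T.tw ?us" and Q: "Q = (\<sigma> ^^ Suc h) (T.tw ?vs)"
    unfolding P_def Q_def T.prod_list_eq_twisted_prod by simp_all
  have "cls C = T.L P \<otimes>\<^bsub>U\<^esub> T.R (Q * c ^ q) \<otimes>\<^bsub>U\<^esub> S [^]\<^bsub>U\<^esub> (t * m + r)"
    using T.context_normal_form[OF assms(12) leaves]
    unfolding P Q U_def cls_def S_def assms(13)[symmetric] assms(15)[symmetric] by simp
  then have normal_form: "cls C = L \<otimes>\<^bsub>U\<^esub> R \<otimes>\<^bsub>U\<^esub> S [^]\<^bsub>U\<^esub> r"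
    unfolding L_def R_def S_def U_def cls_def aC_def bC_def T.L_R_S_pow_reduce mult.assoc .
  have act_S: "act S y = \<sigma> y" for y
  proof -
    have "act S y = T.tw ([1] @ y # replicate (m - 2) 1 @ [ci]) * c"
      using T.context_act_one_vertex[of "[1]" "replicate (m - 2) 1 @ [ci]" y] T.m_ge_2
      by (simp add: act_def S_def cls_def T.regular_act_cls S_context_def map_replicate_const)
    then show ?thesis
      by (simp add: T.twisted_prod_append T.twisted_prod_ones T.funpow_\<sigma> T.\<sigma>_one T.\<sigma>_mult T.\<sigma>_ci
          T.c_inverse mult.assoc)
  qed
  have act_C: "act (cls C) y = P * (\<sigma> ^^ h) y * Q * c ^ q" for y
    unfolding act_def cls_def T.regular_act_cls T.context_act_closed_form[OF full leaves] P Q assms(13)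
    by simp
  have "(\<sigma> ^^ h) y = c ^ t * (\<sigma> ^^ r) y * ci ^ t" for y
    by (simp add: assms(15) funpow_add T.funpow_\<sigma>_m)
  then have closed: "aC * (act S ^^ r) y * bC = P * (\<sigma> ^^ h) y * Q * c ^ q" for y
    unfolding aC_def bC_def act_S[THEN ext] by (simp only: mult.assoc)
  show ?thesis
    using normal_form act_S act_C closed by simp
qed

end
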